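(* Suppose $\mathbb{P}(B>x)=L(x)x^{-\alpha}$ for some $\alpha>2$, $\alpha\neq 3$, and $L$ slowly varying. Let $\hat{x}_\rho$ (a function of $\rho$) satisfy $\mathbb{P}(B>\hat{x}_\rho)/(1-\rho)^2\rightarrow 0$ as $\rho\uparrow 1$. Then the relation $$\sup_{x\geq\hat{x}_\rho}\left|\frac{\mathbb{P}(B_\tau>x)}{\frac{1}{1-\rho}\mathbb{P}(B>x)}-1\right|\rightarrow 0$$ holds as $\rho\uparrow 1$. In particular, this holds whenever $\hat{x}_\rho\geq 1/(1-\rho)$.
   Context: Let $B,B_0,B_1,B_2,\ldots$ be i.i.d. non-negative random variables with $\mathbb{P}(B\le 0)=0$, mean $\mathbb{E}[B]>0$ and finite variance. A function $L$ is slowly varying if $\lim_{x\to\infty}L(ax)/L(x)=1$ for all $a>0$. Let $N^1(t)$, $t\ge 0$, be a Poisson process with rate $1/\mathbb{E}[B]$, independent of the $B_i$; for $\rho\in(0,1)$ let $N^\rho(t):=N^1(\rho t)$, a Poisson process with rate $\rho/\mathbb{E}[B]$. Define $X(t)=X^\rho(t):=X_0+\sum_{i=1}^{N^\rho(t)}B_i-t$ for $t\ge 0$, with $X_0:=B_0$. Let $\tau=\tau^\rho:=\inf\{t\ge 0:X^\rho(t)=0\}$ be the first hitting time of zero, and let $B_\tau=B_\tau^\rho:=\sup\{B_i:0\le i\le N^\rho(\tau^\rho)\}$ be the largest jump (including the initial value $B_0$) up to time $\tau$. The distribution of $B$ does not depend on $\rho$. *)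

theory Defs
  imports "HOL-Probability.Probability"
begin

definition slowly_varying :: "(real \<Rightarrow> real) \<Rightarrow> bool" where
  "slowly_varying L \<longleftrightarrow> (\<forall>a>0. ((\<lambda>x. L (a * x) / L x) \<longlongrightarrow> 1) at_top)"

(* Only times t \<ge> 0 matter. The paths are nondecreasing, so the truncated subtraction on nat
   gives the genuine increments; nat carries the discrete topology, so right-continuity says
   that each path is locally constant to the right. *)
definition poisson_process :: "'a measure \<Rightarrow> real \<Rightarrow> (real \<Rightarrow> 'a \<Rightarrow> nat) \<Rightarrow> bool" where
  "poisson_process M r N \<longleftrightarrow>
     (\<forall>t\<ge>0. N t \<in> M \<rightarrow>\<^sub>M count_space UNIV) \<and>
     (\<forall>\<omega>\<in>space M. N 0 \<omega> = 0 \<and> mono_on {0..} (\<lambda>t. N t \<omega>) \<and>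
        (\<forall>t\<ge>0. continuous (at_right t) (\<lambda>s. N s \<omega>))) \<and>
     (\<forall>s t. 0 \<le> s \<and> s < t \<longrightarrow>
        distr M (count_space UNIV) (\<lambda>\<omega>. N t \<omega> - N s \<omega>) = measure_pmf (poisson_pmf (r * (t - s)))) \<and>
     (\<forall>(n::nat) (t :: nat \<Rightarrow> real). 0 \<le> t 0 \<and> (\<forall>i<n. t i \<le> t (Suc i)) \<longrightarrow>
        prob_space.indep_vars M (\<lambda>_. count_space UNIV)
          (\<lambda>i \<omega>. N (t (Suc i)) \<omega> - N (t i) \<omega>) {..<n})"

(* In the following, Bs is the sequence B_0, B_1, ... and N is the process N^1, so that
   N (\<rho> * t) is N^\<rho>(t). *)

definition workload ::
  "(nat \<Rightarrow> 'a \<Rightarrow> real) \<Rightarrow> (real \<Rightarrow> 'a \<Rightarrow> nat) \<Rightarrow> real \<Rightarrow> real \<Rightarrow> 'a \<Rightarrow> real" where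
  "workload Bs N \<rho> t \<omega> = Bs 0 \<omega> + (\<Sum>i=1..N (\<rho> * t) \<omega>. Bs i \<omega>) - t"

(* Extended-real valued: the value is \<infinity> if zero is never hit. *)
definition hitting_time ::
  "(nat \<Rightarrow> 'a \<Rightarrow> real) \<Rightarrow> (real \<Rightarrow> 'a \<Rightarrow> nat) \<Rightarrow> real \<Rightarrow> 'a \<Rightarrow> ereal" where
  "hitting_time Bs N \<rho> \<omega> = Inf (ereal ` {t. 0 \<le> t \<and> workload Bs N \<rho> t \<omega> = 0})"

(* As N is nondecreasing, the index set is {i. i \<le> N^\<rho>(\<tau>)} when \<tau> is finite; for infinite \<tau>
   the value N^\<rho>(\<infinity>) is read as the limit of N^\<rho>(t). *)
definition largest_jump ::
  "(nat \<Rightarrow> 'a \<Rightarrow> real) \<Rightarrow> (real \<Rightarrow> 'a \<Rightarrow> nat) \<Rightarrow> real \<Rightarrow> 'a \<Rightarrow> ereal" where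
  "largest_jump Bs N \<rho> \<omega> =
     (SUP i \<in> {i. \<exists>t\<ge>0. ereal t \<le> hitting_time Bs N \<rho> \<omega> \<and> i \<le> N (\<rho> * t) \<omega>}. ereal (Bs i \<omega>))"

end

theory Submission
  imports Defs "HOL-Real_Asymp.Real_Asymp"
begin

text \<open>
  Read \<open>X\<close> as the workload of a single-server queue: the jumps are the service times of the customers
  \<open>0, 1, 2, \<dots>\<close>, and \<open>\<tau>\<close> is the end of the first busy period. Let \<open>\<sigma>\<close> be the number of customers served
  in that busy period and \<open>A\<^sub>i\<close> the number of customers who arrive while customer \<open>i\<close> is in service.
  Customer \<open>n\<close> is served iff \<open>A\<^sub>0 + \<dots> + A\<^sub>m\<^sub>-\<^sub>1 \<ge> m\<close> for all \<open>1 \<le> m \<le> n\<close>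
  (\<open>index_before_hitting_iff\<close>, \<open>sum_arrivals\<close>), so the event \<open>n < \<sigma>\<close> depends on the past \<open>A\<^sub>0, \<dots>, A\<^sub>n\<^sub>-\<^sub>1\<close>
  only, while \<open>B\<^sub>\<tau> > x\<close> says that \<open>B\<^sub>n > x\<close> for some \<open>n < \<sigma>\<close>. The pairs \<open>(A\<^sub>i, B\<^sub>i)\<close> are i.i.d.
  (\<open>indep_pairs\<close>), \<open>A\<^sub>i\<close> has mean \<open>\<rho>\<close>, and its variance is bounded by a constant \<open>v\<close> independent of \<open>\<rho>\<close>.
  
  Write \<open>p = P(B > x)\<close>. Since \<open>n < \<sigma>\<close> is independent of \<open>B\<^sub>n\<close>, the expected number of served customers
  with \<open>B\<^sub>n > x\<close> is \<open>p E[\<sigma>] = p / (1 - \<rho>)\<close>, and the union bound gives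
  \<open>P(B\<^sub>\<tau> > x) \<le> p / (1 - \<rho>)\<close> for every \<open>x\<close> (\<open>exceedance_le\<close>). For the lower bound, decompose according
  to the first customer with \<open>B\<^sub>n > x\<close>. With \<open>K\<close> the event \<open>B\<^sub>\<tau> > x\<close>,
  \<open>P(K) = p * (\<Sum>n. P(n < \<sigma> and B\<^sub>j \<le> x for all j < n)) \<ge> p * (E[\<sigma>] - E[\<sigma>; K])\<close>,
  and the Cauchy-Schwarz inequality bounds \<open>E[\<sigma>; K]\<close> by the square root of
  \<open>E[\<sigma>\<^sup>2] P(K) \<le> (v + 1) (1 - \<rho>)\<^sup>-\<^sup>3 p (1 - \<rho>)\<^sup>-\<^sup>1\<close>. Hence the ratio of \<open>P(B\<^sub>\<tau> > x)\<close> to \<open>p / (1 - \<rho>)\<close>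
  differs from \<open>1\<close> by at most the square root of \<open>(v + 1) p / (1 - \<rho>)\<^sup>2\<close> (\<open>exceedance_ge\<close>). This error
  decreases in \<open>x\<close>, so its value at \<open>x = xh \<rho>\<close> bounds the supremum, and the condition on \<open>xh\<close> says
  exactly that this value tends to \<open>0\<close>. In the case \<open>xh \<rho> \<ge> y = 1 / (1 - \<rho>)\<close> the condition
  follows from \<open>y\<^sup>2 P(B > y) \<rightarrow> 0\<close>, which is a consequence of the finite second moment.
  
  The two moments of \<open>\<sigma>\<close> come from the martingale with increments \<open>A\<^sub>i - \<rho>\<close> stopped at \<open>\<sigma>\<close>
  (\<open>noise_sq\<close>, \<open>served_le_noise\<close>). As \<open>\<sigma>\<close> could be infinite on a null set, all estimates are made for the
  minimum \<open>\<sigma> \<and> n\<close> of \<open>\<sigma>\<close> and a finite \<open>n\<close>, which tends to infinity at the end.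
\<close>

section \<open>The number of customers in a busy period\<close>

text \<open>
  If \<open>a i\<close> customers arrive during service \<open>i\<close>, then service \<open>n\<close> belongs to the busy period started by
  customer \<open>0\<close> iff the server has never run out of waiting customers at the end of one of the services
  \<open>0, \<dots>, n - 1\<close>.
\<close>
definition alive :: "(nat \<Rightarrow> nat) \<Rightarrow> nat \<Rightarrow> bool" where
  "alive a n \<longleftrightarrow> (\<forall>m\<in>{1..n}. m \<le> (\<Sum>i<m. a i))"

lemma alive_0 [simp]: "alive a 0"
  by (simp add: alive_def)

lemma alive_Suc: "alive a (Suc n) \<longleftrightarrow> alive a n \<and> Suc n \<le> (\<Sum>i<Suc n. a i)"
  by (auto simp: alive_def le_Suc_eq simp del: sum.lessThan_Suc)

lemma alive_le_sum: "alive a n \<Longrightarrow> n \<le> (\<Sum>i<n. a i)"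
  by (cases "n = 0") (auto simp: alive_def)

lemma alive_antimono: "alive a n \<Longrightarrow> m \<le> n \<Longrightarrow> alive a m"
  by (auto simp: alive_def)

lemma alive_cong: "(\<And>i. i < n \<Longrightarrow> a i = b i) \<Longrightarrow> alive a n \<longleftrightarrow> alive b n"
  by (auto simp: alive_def intro!: ball_cong)

lemma measurable_alive:
  assumes "\<And>i. i < n \<Longrightarrow> (\<lambda>x. real (a i x)) \<in> borel_measurable M"
  shows "Measurable.pred M (\<lambda>x. alive (\<lambda>i. a i x) n)"
proof -
  have "alive (\<lambda>i. a i x) n \<longleftrightarrow> (\<forall>m\<in>{1..n}. real m \<le> (\<Sum>i<m. real (a i x)))" for x
    unfolding alive_def of_nat_sum[symmetric] of_nat_le_iff ..
  moreover have "(\<lambda>x. \<Sum>i<m. real (a i x)) \<in> borel_measurable M" if "m \<in> {1..n}" for m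
    using that by (intro borel_measurable_sum assms) auto
  ultimately show ?thesis
    by (auto intro!: pred_intros_finite)
qed

text \<open>
  The queue loses at most one customer per service, so the walk \<open>\<Sum>i<n. (a i - 1)\<close>, stopped at the end of the
  busy period, stops exactly at \<open>-1\<close> and cannot jump below it.
\<close>
lemma sum_alive_excess:
  "(\<Sum>i<n. of_bool (alive a i) * (real (a i) - 1)) =
     (if alive a n then (\<Sum>i<n. real (a i)) - n else -1)"
proof (induction n)
  case 0
  then show ?case by simp
next
  case (Suc n)
  show ?case
  proof (cases "alive a n \<and> \<not> alive a (Suc n)")
    case True
    then have "(\<Sum>i<Suc n. a i) \<le> n"
      by (auto simp: alive_Suc simp del: sum.lessThan_Suc)
    moreover have "n \<le> (\<Sum>i<n. a i)"
      using True by (simp add: alive_le_sum)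
    ultimately have "(\<Sum>i<n. a i) + a n = n" by simp
    then have "(\<Sum>i<n. real (a i)) + real (a n) = real n"
      by (metis of_nat_add of_nat_sum)
    then show ?thesis using Suc.IH True by simp
  next
    case False
    then show ?thesis using Suc.IH by (auto simp: alive_Suc)
  qed
qed

lemma sum_alive_le: "(\<Sum>i<n. of_bool (alive a i)) \<le> real n"
  using sum_mono[of "{..<n}" "\<lambda>i. of_bool (alive a i)" "\<lambda>_. 1::real"] by simp

lemma sum_alive_eq: "alive a n \<Longrightarrow> (\<Sum>i<n. of_bool (alive a i)) = real n"
  using alive_antimono[of a n] by (simp add: less_imp_le)

lemma (in prob_space) expectation_of_bool:
  "expectation (\<lambda>\<omega>. of_bool (P \<omega>)) = \<P>(\<omega> in M. P \<omega>)"
proof -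
  have "(\<lambda>\<omega>. of_bool (P \<omega>) :: real) = indicator {\<omega>. P \<omega>}"
    by (auto simp: fun_eq_iff)
  then show ?thesis
    by (simp add: Int_def conj_commute)
qed

text \<open>
  The Cauchy-Schwarz inequality for a random variable and an indicator, obtained by minimising the
  nonnegative quadratic \<open>s \<mapsto> E[(X - s 1\<^sub>P)\<^sup>2]\<close>.
\<close>
lemma (in prob_space) expectation_event_le_sqrt:
  assumes [measurable]: "random_variable borel X" "Measurable.pred M P"
    and sq: "integrable M (\<lambda>\<omega>. (X \<omega>)\<^sup>2)"
  shows "integrable M (\<lambda>\<omega>. X \<omega> * of_bool (P \<omega>))"
    and "expectation (\<lambda>\<omega>. X \<omega> * of_bool (P \<omega>)) \<le> sqrt (expectation (\<lambda>\<omega>. (X \<omega>)\<^sup>2) * \<P>(\<omega> in M. P \<omega>))"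
proof -
  have X: "integrable M X"
    by (rule square_integrable_imp_integrable[OF _ sq]) simp
  show int: "integrable M (\<lambda>\<omega>. X \<omega> * of_bool (P \<omega>))"
    by (rule Bochner_Integration.integrable_bound[OF X]) auto
  define p where "p = \<P>(\<omega> in M. P \<omega>)"
  have p: "expectation (\<lambda>\<omega>. of_bool (P \<omega>)) = p"
    unfolding p_def by (rule expectation_of_bool)
  have intP: "integrable M (\<lambda>\<omega>. of_bool (P \<omega>) :: real)"
    by (rule integrable_const_bound[where B=1]) auto
  define a where "a = expectation (\<lambda>\<omega>. X \<omega> * of_bool (P \<omega>))"
  have quad: "0 \<le> expectation (\<lambda>\<omega>. (X \<omega>)\<^sup>2) - 2 * s * a + s\<^sup>2 * p" for s
  proof -
    have "0 \<le> expectation (\<lambda>\<omega>. (X \<omega> - s * of_bool (P \<omega>))\<^sup>2)"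
      by (rule integral_nonneg_AE) simp
    also have "(\<lambda>\<omega>. (X \<omega> - s * of_bool (P \<omega>))\<^sup>2) =
        (\<lambda>\<omega>. (X \<omega>)\<^sup>2 - (2 * s) * (X \<omega> * of_bool (P \<omega>)) + s\<^sup>2 * of_bool (P \<omega>))"
      by (auto simp: fun_eq_iff power2_eq_square algebra_simps)
    also have "expectation \<dots> = expectation (\<lambda>\<omega>. (X \<omega>)\<^sup>2) - 2 * s * a + s\<^sup>2 * p"
      using sq int intP by (simp add: a_def p)
    finally show ?thesis .
  qed
  have "a\<^sup>2 \<le> expectation (\<lambda>\<omega>. (X \<omega>)\<^sup>2) * p"
  proof (cases "p = 0")
    case True
    then have "AE \<omega> in M. \<not> P \<omega>"
      unfolding p_def by (subst (asm) prob_eq_0) auto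
    then have "a = 0"
      unfolding a_def by (intro integral_eq_zero_AE) auto
    with True show ?thesis by simp
  next
    case False
    then have "p > 0" unfolding p_def by (simp add: zero_less_measure_iff)
    then show ?thesis
      using quad[of "a / p"] by (simp add: field_simps power2_eq_square)
  qed
  then show "expectation (\<lambda>\<omega>. X \<omega> * of_bool (P \<omega>)) \<le> sqrt (expectation (\<lambda>\<omega>. (X \<omega>)\<^sup>2) * \<P>(\<omega> in M. P \<omega>))"
    unfolding a_def[symmetric] p_def[symmetric] by (rule real_le_rsqrt)
qed

text \<open>
  \<open>X i\<close> is the service time of customer \<open>i\<close> and \<open>A i\<close> the number of arrivals during that service. The two
  are dependent for the same \<open>i\<close>; independence is required of the pairs only.
\<close>
locale iid_queue = prob_space M for M :: "'a measure" +
  fixes A :: "nat \<Rightarrow> 'a \<Rightarrow> nat" and X :: "nat \<Rightarrow> 'a \<Rightarrow> real" and r v :: real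
  assumes indep: "indep_vars (\<lambda>_. count_space UNIV \<Otimes>\<^sub>M borel) (\<lambda>i \<omega>. (A i \<omega>, X i \<omega>)) UNIV"
    and load: "r < 1"
    and square_integrable: "\<And>i. integrable M (\<lambda>\<omega>. (real (A i \<omega>))\<^sup>2)"
    and mean: "\<And>i. expectation (\<lambda>\<omega>. real (A i \<omega>)) = r"
    and var: "\<And>i. expectation (\<lambda>\<omega>. (real (A i \<omega>) - r)\<^sup>2) \<le> v"
begin

abbreviation Z :: "nat \<Rightarrow> 'a \<Rightarrow> nat \<times> real" where
  "Z i \<omega> \<equiv> (A i \<omega>, X i \<omega>)"

abbreviation live :: "nat \<Rightarrow> 'a \<Rightarrow> bool" where
  "live n \<omega> \<equiv> alive (\<lambda>i. A i \<omega>) n"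

text \<open>
  This is \<open>\<sigma> \<and> n\<close> for the number \<open>\<sigma>\<close> of customers in the busy period.
\<close>
definition served :: "nat \<Rightarrow> 'a \<Rightarrow> real" where
  "served n \<omega> = (\<Sum>i<n. of_bool (live i \<omega>))"

text \<open>
  This is the martingale with increments \<open>A i - r\<close>, stopped after \<open>\<sigma>\<close> steps.
\<close>
definition noise :: "nat \<Rightarrow> 'a \<Rightarrow> real" where
  "noise n \<omega> = (\<Sum>i<n. of_bool (live i \<omega>) * (real (A i \<omega>) - r))"

lemma measurable_Z: "Z i \<in> M \<rightarrow>\<^sub>M count_space UNIV \<Otimes>\<^sub>M borel"
  using indep by (auto simp: indep_vars_def)

lemma measurable_A [measurable]: "A i \<in> M \<rightarrow>\<^sub>M count_space UNIV"
  using measurable_fst'[OF measurable_Z] by simp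

lemma measurable_X [measurable]: "X i \<in> borel_measurable M"
  using measurable_snd'[OF measurable_Z] by simp

lemma measurable_live [measurable]: "Measurable.pred M (live n)"
  by (rule measurable_alive) measurable

text \<open>
  The basic use of independence: a function \<open>G\<close> of the pairs before \<open>n\<close>, which is presented as
  \<open>g\<close> of the restricted sequence, is uncorrelated with a function of the pair \<open>n\<close>.
\<close>
lemma expectation_past_present:
  fixes g :: "(nat \<Rightarrow> nat \<times> real) \<Rightarrow> real" and h :: "nat \<times> real \<Rightarrow> real"
  assumes g: "g \<in> borel_measurable (PiM {..<n} (\<lambda>_. count_space UNIV \<Otimes>\<^sub>M borel))"
    and h: "h \<in> borel_measurable (count_space UNIV \<Otimes>\<^sub>M borel)"
    and G: "\<And>\<omega>. g (\<lambda>i\<in>{..<n}. Z i \<omega>) = G \<omega>"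
    and int: "integrable M G" "integrable M (\<lambda>\<omega>. h (Z n \<omega>))"
  shows "integrable M (\<lambda>\<omega>. G \<omega> * h (Z n \<omega>))"
    and "expectation (\<lambda>\<omega>. G \<omega> * h (Z n \<omega>)) = expectation G * expectation (\<lambda>\<omega>. h (Z n \<omega>))"
proof -
  let ?P = "\<lambda>J. PiM J (\<lambda>_. count_space UNIV \<Otimes>\<^sub>M borel) :: (nat \<Rightarrow> nat \<times> real) measure"
  have "indep_var (?P {..<n}) (\<lambda>\<omega>. restrict (\<lambda>i. Z i \<omega>) {..<n}) (?P {n}) (\<lambda>\<omega>. restrict (\<lambda>i. Z i \<omega>) {n})"
    by (rule indep_var_restrict[OF indep]) auto
  then have "indep_var borel (g \<circ> (\<lambda>\<omega>. restrict (\<lambda>i. Z i \<omega>) {..<n}))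
      borel ((\<lambda>z. h (z n)) \<circ> (\<lambda>\<omega>. restrict (\<lambda>i. Z i \<omega>) {n}))"
    using g by (rule indep_var_compose)
      (intro measurable_compose[OF _ h] measurable_component_singleton, simp)
  then have ind: "indep_var borel G borel (\<lambda>\<omega>. h (Z n \<omega>))"
    by (simp add: o_def G)
  show "integrable M (\<lambda>\<omega>. G \<omega> * h (Z n \<omega>))"
    by (rule indep_var_integrable[OF ind int])
  show "expectation (\<lambda>\<omega>. G \<omega> * h (Z n \<omega>)) = expectation G * expectation (\<lambda>\<omega>. h (Z n \<omega>))"
    by (rule indep_var_lebesgue_integral[OF ind int])
qed

text \<open>
  Whether customer \<open>n\<close> is served is decided by the pairs before \<open>n\<close>; the next two lemmas put this into the form
  in which \<open>expectation_past_present\<close> applies.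
\<close>
lemma measurable_past_live:
  assumes "i \<le> n"
  shows "Measurable.pred (PiM {..<n} (\<lambda>_. count_space UNIV \<Otimes>\<^sub>M (borel :: real measure)))
           (\<lambda>z. alive (\<lambda>j. fst (z j)) i)"
proof (rule measurable_alive)
  fix j assume "j < i"
  then have "(\<lambda>z. z j) \<in> PiM {..<n} (\<lambda>_. count_space UNIV \<Otimes>\<^sub>M (borel :: real measure))
      \<rightarrow>\<^sub>M count_space (UNIV :: nat set) \<Otimes>\<^sub>M borel"
    using assms by (intro measurable_component_singleton) auto
  then show "(\<lambda>z. real (fst (z j))) \<in> borel_measurable (PiM {..<n} (\<lambda>_. count_space UNIV \<Otimes>\<^sub>M (borel :: real measure)))"
    by measurable
qed

lemma past_live:
  assumes "i \<le> n"
  shows "alive (\<lambda>j. fst ((\<lambda>j\<in>{..<n}. Z j \<omega>) j)) i \<longleftrightarrow> live i \<omega>"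
  using assms by (intro alive_cong) auto

lemma integrable_A [simp]: "integrable M (\<lambda>\<omega>. real (A i \<omega>))"
  by (rule square_integrable_imp_integrable[OF _ square_integrable]) simp

lemma integrable_live [simp]: "integrable M (\<lambda>\<omega>. of_bool (live n \<omega>) :: real)"
  by (rule integrable_const_bound[where B=1]) auto

lemma expectation_live: "expectation (\<lambda>\<omega>. of_bool (live n \<omega>)) = \<P>(\<omega> in M. live n \<omega>)"
  by (rule expectation_of_bool)

lemma integrable_centred [simp]:
  "integrable M (\<lambda>\<omega>. real (A i \<omega>) - r)" "integrable M (\<lambda>\<omega>. (real (A i \<omega>) - r)\<^sup>2)"
  by (auto simp: power2_diff square_integrable)

lemma integrable_noise [simp]: "integrable M (noise n)"
  unfolding noise_def
proof (rule Bochner_Integration.integrable_sum)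
  show "integrable M (\<lambda>\<omega>. of_bool (live i \<omega>) * (real (A i \<omega>) - r))" for i
    by (rule Bochner_Integration.integrable_bound[OF integrable_centred(1)[of i]]) auto
qed

lemma expectation_live_times:
  assumes h: "h \<in> borel_measurable (count_space UNIV \<Otimes>\<^sub>M borel)"
    and int: "integrable M (\<lambda>\<omega>. h (Z n \<omega>) :: real)"
  shows "integrable M (\<lambda>\<omega>. of_bool (live n \<omega>) * h (Z n \<omega>))"
    and "expectation (\<lambda>\<omega>. of_bool (live n \<omega>) * h (Z n \<omega>)) = \<P>(\<omega> in M. live n \<omega>) * expectation (\<lambda>\<omega>. h (Z n \<omega>))"
proof -
  have g: "(\<lambda>z. of_bool (alive (\<lambda>j. fst (z j)) n) :: real)
      \<in> borel_measurable (PiM {..<n} (\<lambda>_. count_space UNIV \<Otimes>\<^sub>M (borel :: real measure)))"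
    using measurable_past_live[of n n] by measurable
  have G: "of_bool (alive (\<lambda>j. fst ((\<lambda>i\<in>{..<n}. Z i \<omega>) j)) n) = (of_bool (live n \<omega>) :: real)" for \<omega>
    by (simp add: past_live del: restrict_apply)
  show "integrable M (\<lambda>\<omega>. of_bool (live n \<omega>) * h (Z n \<omega>))"
    by (rule expectation_past_present(1)[OF g h G integrable_live int])
  show "expectation (\<lambda>\<omega>. of_bool (live n \<omega>) * h (Z n \<omega>)) = \<P>(\<omega> in M. live n \<omega>) * expectation (\<lambda>\<omega>. h (Z n \<omega>))"
    by (subst expectation_past_present(2)[OF g h G integrable_live int]) (simp add: expectation_live)
qed

lemma expectation_noise: "expectation (noise n) = 0"
proof -
  have "expectation (\<lambda>\<omega>. of_bool (live i \<omega>) * (real (A i \<omega>) - r)) = 0" for i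
    using expectation_live_times(2)[of "\<lambda>z. real (fst z) - r" i] mean[of i]
    by (simp add: prob_space)
  moreover have "integrable M (\<lambda>\<omega>. of_bool (live i \<omega>) * (real (A i \<omega>) - r))" for i
    using expectation_live_times(1)[of "\<lambda>z. real (fst z) - r" i] by simp
  ultimately show ?thesis
    unfolding noise_def by (subst Bochner_Integration.integral_sum) auto
qed

lemma integrable_served [simp]: "integrable M (served n)"
  unfolding served_def by (intro Bochner_Integration.integrable_sum integrable_live)

lemma expectation_served: "expectation (served n) = (\<Sum>i<n. \<P>(\<omega> in M. live i \<omega>))"
  unfolding served_def by (subst Bochner_Integration.integral_sum) (auto simp: expectation_live)

lemma measurable_noise [measurable]: "noise n \<in> borel_measurable M"
  and measurable_served [measurable]: "served n \<in> borel_measurable M"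
  using integrable_noise integrable_served by (auto intro: borel_measurable_integrable)

text \<open>
  The cross terms of a martingale vanish, so the second moment is the sum of those of the increments.
  This is the second Wald identity for \<open>\<sigma> \<and> n\<close>, with the variance replaced by its bound \<open>v\<close>.
\<close>
lemma noise_sq:
  "integrable M (\<lambda>\<omega>. (noise n \<omega>)\<^sup>2) \<and> expectation (\<lambda>\<omega>. (noise n \<omega>)\<^sup>2) \<le> v * expectation (served n)"
proof (induction n)
  case 0
  then show ?case by (simp add: noise_def served_def)
next
  case (Suc n)
  let ?D = "\<lambda>\<omega>. real (A n \<omega>) - r"
  have expand: "(noise (Suc n) \<omega>)\<^sup>2 =
      (noise n \<omega>)\<^sup>2 + 2 * ((noise n \<omega> * of_bool (live n \<omega>)) * ?D \<omega>) + of_bool (live n \<omega>) * (?D \<omega>)\<^sup>2" for \<omega>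
    by (auto simp: noise_def power2_eq_square algebra_simps)
  let ?g = "\<lambda>z. (\<Sum>i<n. of_bool (alive (\<lambda>j. fst (z j)) i) * (real (fst (z i)) - r)) *
      (of_bool (alive (\<lambda>j. fst (z j)) n) :: real)"
  have comp [measurable]: "(\<lambda>z. z i) \<in> PiM {..<n} (\<lambda>_. count_space UNIV \<Otimes>\<^sub>M (borel :: real measure))
      \<rightarrow>\<^sub>M count_space (UNIV :: nat set) \<Otimes>\<^sub>M borel" if "i < n" for i
    using that by (intro measurable_component_singleton) auto
  have summand: "(\<lambda>z. of_bool (alive (\<lambda>j. fst (z j)) i) * (real (fst (z i)) - r))
      \<in> borel_measurable (PiM {..<n} (\<lambda>_. count_space UNIV \<Otimes>\<^sub>M (borel :: real measure)))" if "i < n" for i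
  proof (intro borel_measurable_times)
    show "(\<lambda>z. of_bool (alive (\<lambda>j. fst (z j)) i) :: real)
        \<in> borel_measurable (PiM {..<n} (\<lambda>_. count_space UNIV \<Otimes>\<^sub>M (borel :: real measure)))"
      using measurable_past_live[OF less_imp_le[OF that]] by measurable
    show "(\<lambda>z. real (fst (z i)) - r) \<in> borel_measurable (PiM {..<n} (\<lambda>_. count_space UNIV \<Otimes>\<^sub>M (borel :: real measure)))"
      using comp[OF that] by measurable
  qed
  have g: "?g \<in> borel_measurable (PiM {..<n} (\<lambda>_. count_space UNIV \<Otimes>\<^sub>M (borel :: real measure)))"
  proof (rule borel_measurable_times)
    show "(\<lambda>z. \<Sum>i<n. of_bool (alive (\<lambda>j. fst (z j)) i) * (real (fst (z i)) - r))
        \<in> borel_measurable (PiM {..<n} (\<lambda>_. count_space UNIV \<Otimes>\<^sub>M (borel :: real measure)))"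
      by (intro borel_measurable_sum summand) simp
    show "(\<lambda>z. of_bool (alive (\<lambda>j. fst (z j)) n) :: real)
        \<in> borel_measurable (PiM {..<n} (\<lambda>_. count_space UNIV \<Otimes>\<^sub>M (borel :: real measure)))"
      using measurable_past_live[of n n] by measurable
  qed
  have G: "?g (\<lambda>i\<in>{..<n}. Z i \<omega>) = noise n \<omega> * of_bool (live n \<omega>)" for \<omega>
  proof (unfold noise_def, intro arg_cong2[where f="(*)"] sum.cong refl)
    show "of_bool (alive (\<lambda>j. fst ((\<lambda>i\<in>{..<n}. Z i \<omega>) j)) n) = (of_bool (live n \<omega>) :: real)"
      by (simp only: past_live order.refl)
    fix i assume "i \<in> {..<n}"
    then show "of_bool (alive (\<lambda>j. fst ((\<lambda>i\<in>{..<n}. Z i \<omega>) j)) i) = (of_bool (live i \<omega>) :: real)"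
      by (subst past_live) (auto simp: less_imp_le)
    show "real (fst ((\<lambda>i\<in>{..<n}. Z i \<omega>) i)) - r = real (A i \<omega>) - r"
      using \<open>i \<in> {..<n}\<close> by simp
  qed
  have int1: "integrable M (\<lambda>\<omega>. noise n \<omega> * of_bool (live n \<omega>))"
    by (rule Bochner_Integration.integrable_bound[OF integrable_noise[of n]]) (auto simp: abs_mult)
  note c = expectation_past_present[OF g _ G int1, of "\<lambda>z. real (fst z) - r"]
  have c1: "integrable M (\<lambda>\<omega>. (noise n \<omega> * of_bool (live n \<omega>)) * ?D \<omega>)"
    using c(1) by simp
  have c2: "expectation (\<lambda>\<omega>. (noise n \<omega> * of_bool (live n \<omega>)) * ?D \<omega>) = 0"
    using c(2) mean[of n] by (simp add: prob_space)
  note d = expectation_live_times[of "\<lambda>z. (real (fst z) - r)\<^sup>2" n]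
  have d1: "integrable M (\<lambda>\<omega>. of_bool (live n \<omega>) * (?D \<omega>)\<^sup>2)"
    using d(1) by simp
  have d2: "expectation (\<lambda>\<omega>. of_bool (live n \<omega>) * (?D \<omega>)\<^sup>2) \<le> \<P>(\<omega> in M. live n \<omega>) * v"
    using d(2) var[of n] by (simp add: mult_left_mono)
  have int: "integrable M (\<lambda>\<omega>. (noise (Suc n) \<omega>)\<^sup>2)"
    unfolding expand using Suc c1 d1
    by (intro Bochner_Integration.integrable_add Bochner_Integration.integrable_mult_right) auto
  have "expectation (\<lambda>\<omega>. (noise (Suc n) \<omega>)\<^sup>2) =
      expectation (\<lambda>\<omega>. (noise n \<omega>)\<^sup>2) + 2 * 0 + expectation (\<lambda>\<omega>. of_bool (live n \<omega>) * (?D \<omega>)\<^sup>2)"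
    unfolding expand using Suc c1 c2 d1 by simp
  also have "\<dots> \<le> v * expectation (served n) + \<P>(\<omega> in M. live n \<omega>) * v"
    using Suc d2 by simp
  also have "\<dots> = v * expectation (served (Suc n))"
    by (simp add: expectation_served algebra_simps)
  finally show ?case using int by blast
qed

lemma noise_eq:
  "noise n \<omega> = (if live n \<omega> then (\<Sum>i<n. real (A i \<omega>)) - n else -1) + (1 - r) * served n \<omega>"
  unfolding noise_def served_def sum_alive_excess[symmetric] sum_distrib_left sum.distrib[symmetric]
  by (intro sum.cong) (auto simp: algebra_simps)

text \<open>
  Compensating the stopped walk, which is at least \<open>-1\<close>, expresses \<open>\<sigma> \<and> n\<close> through the martingale. Thus the
  martingale estimates transfer to \<open>\<sigma> \<and> n\<close> although the walk itself is unbounded above.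
\<close>
lemma served_le_noise: "(1 - r) * served n \<omega> \<le> noise n \<omega> + 1"
proof -
  have "live n \<omega> \<Longrightarrow> real n \<le> (\<Sum>i<n. real (A i \<omega>))"
    unfolding of_nat_sum[symmetric] of_nat_le_iff by (rule alive_le_sum)
  then show ?thesis unfolding noise_eq by auto
qed

lemma r_nonneg: "0 \<le> r"
  using mean[of 0] by (metis Bochner_Integration.integral_nonneg of_nat_0_le_iff)

lemma v_nonneg: "0 \<le> v"
  using var[of 0] by (meson Bochner_Integration.integral_nonneg order_trans zero_le_power2)

lemma expectation_served_le: "expectation (served n) \<le> 1 / (1 - r)"
proof -
  have "expectation (\<lambda>\<omega>. (1 - r) * served n \<omega>) \<le> expectation (\<lambda>\<omega>. noise n \<omega> + 1)"
    by (intro integral_mono served_le_noise) auto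
  also have "\<dots> = 1"
    by (simp add: expectation_noise prob_space)
  finally show ?thesis
    using load by (simp add: field_simps)
qed

lemma served_nonneg: "0 \<le> served n \<omega>"
  unfolding served_def by (rule sum_nonneg) simp

lemma served_le: "served n \<omega> \<le> n"
  unfolding served_def by (rule sum_alive_le)

lemma served_eq: "live n \<omega> \<Longrightarrow> served n \<omega> = n"
  unfolding served_def by (rule sum_alive_eq)

lemma integrable_served_sq: "integrable M (\<lambda>\<omega>. (served n \<omega>)\<^sup>2)"
  by (rule integrable_const_bound[where B="(real n)\<^sup>2"])
     (auto intro!: power_mono served_le served_nonneg)

lemma expectation_served_sq_le: "expectation (\<lambda>\<omega>. (served n \<omega>)\<^sup>2) \<le> (v + 1) / (1 - r) ^ 3"
proof -
  have "(1 - r)\<^sup>2 * expectation (\<lambda>\<omega>. (served n \<omega>)\<^sup>2) = expectation (\<lambda>\<omega>. ((1 - r) * served n \<omega>)\<^sup>2)"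
    by (simp add: power_mult_distrib)
  also have "\<dots> \<le> expectation (\<lambda>\<omega>. (noise n \<omega>)\<^sup>2 + 2 * noise n \<omega> + 1)"
  proof (rule integral_mono)
    show "integrable M (\<lambda>\<omega>. ((1 - r) * served n \<omega>)\<^sup>2)"
      using integrable_served_sq by (simp add: power_mult_distrib)
    show "integrable M (\<lambda>\<omega>. (noise n \<omega>)\<^sup>2 + 2 * noise n \<omega> + 1)"
      using noise_sq[of n] by simp
    show "((1 - r) * served n \<omega>)\<^sup>2 \<le> (noise n \<omega>)\<^sup>2 + 2 * noise n \<omega> + 1" for \<omega>
      using power_mono[OF served_le_noise[of n \<omega>], of 2] load served_nonneg[of n \<omega>]
      by (simp add: power2_sum)
  qed
  also have "\<dots> \<le> v * expectation (served n) + 1"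
    using noise_sq[of n] by (simp add: expectation_noise prob_space)
  also have "\<dots> \<le> v * (1 / (1 - r)) + 1 / (1 - r)"
    using expectation_served_le[of n] v_nonneg r_nonneg load
    by (intro add_mono mult_left_mono) (auto simp: field_simps)
  finally have "(1 - r)\<^sup>2 * expectation (\<lambda>\<omega>. (served n \<omega>)\<^sup>2) \<le> (v + 1) / (1 - r)"
    by (simp add: add_divide_distrib)
  then have "(1 - r) ^ 3 * expectation (\<lambda>\<omega>. (served n \<omega>)\<^sup>2) \<le> v + 1"
    using load by (simp add: pos_le_divide_eq power3_eq_cube power2_eq_square mult_ac)
  then show ?thesis
    using load by (simp add: pos_le_divide_eq mult.commute)
qed

lemma prob_live_le: "real n * \<P>(\<omega> in M. live n \<omega>) \<le> 1 / (1 - r)"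
proof -
  have "real n * \<P>(\<omega> in M. live n \<omega>) = expectation (\<lambda>\<omega>. real n * of_bool (live n \<omega>))"
    by (simp add: expectation_live)
  also have "\<dots> \<le> expectation (served n)"
    by (intro integral_mono integrable_served)
       (auto simp: served_nonneg served_eq)
  finally show ?thesis using expectation_served_le[of n] by simp
qed

lemma prob_live_tendsto: "(\<lambda>n. \<P>(\<omega> in M. live n \<omega>)) \<longlonglongrightarrow> 0"
proof (rule tendsto_sandwich[OF _ _ tendsto_const])
  show "(\<lambda>n. (1 / (1 - r)) * inverse (real n)) \<longlonglongrightarrow> 0"
    by (rule tendsto_mult_right_zero[OF lim_inverse_n])
  show "\<forall>\<^sub>F n in sequentially. \<P>(\<omega> in M. live n \<omega>) \<le> (1 / (1 - r)) * inverse (real n)"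
    using eventually_gt_at_top[of "0::nat"]
  proof eventually_elim
    case (elim n)
    then have "\<P>(\<omega> in M. live n \<omega>) \<le> (1 / (1 - r)) / real n"
      using prob_live_le[of n] by (simp only: pos_le_divide_eq of_nat_0_less_iff mult.commute)
    then show ?case by (simp only: divide_inverse)
  qed
qed auto

text \<open>
  This is Wald's identity \<open>E[\<sigma>] = 1 / (1 - r)\<close>. On \<open>\<sigma> \<le> n\<close> the stopped walk is \<open>-1\<close>; on the complementary event
  it is at most the martingale, and this part is negligible because the martingale is bounded in \<open>L\<^sup>2\<close> and
  the event has vanishing probability.
\<close>
lemma expectation_served_tendsto: "(\<lambda>n. expectation (served n)) \<longlonglongrightarrow> 1 / (1 - r)"
proof (rule tendsto_sandwich[OF _ _ _ tendsto_const])
  let ?q = "\<lambda>n. \<P>(\<omega> in M. live n \<omega>)"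
  have "1 - ?q n - sqrt (v / (1 - r) * ?q n) \<le> (1 - r) * expectation (served n)" for n
  proof -
    have "(1 - r) * served n \<omega> \<ge> noise n \<omega> + (1 - of_bool (live n \<omega>)) - noise n \<omega> * of_bool (live n \<omega>)" for \<omega>
      using load served_nonneg[of n \<omega>] by (auto simp: noise_eq[of n \<omega>])
    have cs: "integrable M (\<lambda>\<omega>. noise n \<omega> * of_bool (live n \<omega>))"
      "expectation (\<lambda>\<omega>. noise n \<omega> * of_bool (live n \<omega>)) \<le> sqrt (expectation (\<lambda>\<omega>. (noise n \<omega>)\<^sup>2) * ?q n)"
      using expectation_event_le_sqrt[of "noise n" "live n"] noise_sq[of n] by auto
    have "expectation (\<lambda>\<omega>. (noise n \<omega>)\<^sup>2) \<le> v / (1 - r)"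
      using noise_sq[of n] mult_left_mono[OF expectation_served_le[of n] v_nonneg]
      by simp
    then have "sqrt (expectation (\<lambda>\<omega>. (noise n \<omega>)\<^sup>2) * ?q n) \<le> sqrt (v / (1 - r) * ?q n)"
      by (intro real_sqrt_le_mono mult_right_mono) auto
    moreover have "1 - ?q n - expectation (\<lambda>\<omega>. noise n \<omega> * of_bool (live n \<omega>)) =
      expectation (\<lambda>\<omega>. noise n \<omega> + (1 - of_bool (live n \<omega>)) - noise n \<omega> * of_bool (live n \<omega>))"
      using cs(1) integrable_noise[of n] by (simp add: expectation_noise expectation_live prob_space)
    moreover have "\<dots> \<le> expectation (\<lambda>\<omega>. (1 - r) * served n \<omega>)"
    proof (rule integral_mono)
      show "integrable M (\<lambda>\<omega>. noise n \<omega> + (1 - of_bool (live n \<omega>)) - noise n \<omega> * of_bool (live n \<omega>))"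
        using cs(1) integrable_noise[of n] by simp
      show "noise n \<omega> + (1 - of_bool (live n \<omega>)) - noise n \<omega> * of_bool (live n \<omega>) \<le> (1 - r) * served n \<omega>" for \<omega>
        by fact
    qed simp
    moreover have "expectation (\<lambda>\<omega>. (1 - r) * served n \<omega>) = (1 - r) * expectation (served n)"
      by simp
    ultimately show ?thesis using cs(2) by linarith
  qed
  then have "(1 - ?q n - sqrt (v / (1 - r) * ?q n)) / (1 - r) \<le> expectation (served n)" for n
    using load by (simp add: pos_divide_le_eq mult.commute)
  then show "\<forall>\<^sub>F n in sequentially. (1 - ?q n - sqrt (v / (1 - r) * ?q n)) / (1 - r) \<le> expectation (served n)"
    by simp
  have "(\<lambda>n. (1 - ?q n - sqrt (v / (1 - r) * ?q n)) / (1 - r)) \<longlonglongrightarrow> (1 - 0 - sqrt (v / (1 - r) * 0)) / (1 - r)"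
    using load by (intro tendsto_intros prob_live_tendsto) auto
  then show "(\<lambda>n. (1 - ?q n - sqrt (v / (1 - r) * ?q n)) / (1 - r)) \<longlonglongrightarrow> 1 / (1 - r)"
    by simp
  show "\<forall>\<^sub>F n in sequentially. expectation (served n) \<le> 1 / (1 - r)"
    using expectation_served_le by simp
qed

lemma prob_past_exceed:
  fixes g :: "(nat \<Rightarrow> nat \<times> real) \<Rightarrow> real"
  assumes p: "\<And>n. \<P>(\<omega> in M. x < X n \<omega>) = p"
    and g: "g \<in> borel_measurable (PiM {..<n} (\<lambda>_. count_space UNIV \<Otimes>\<^sub>M (borel :: real measure)))"
    and G: "\<And>\<omega>. g (\<lambda>i\<in>{..<n}. Z i \<omega>) = of_bool (Q \<omega>)"
    and [measurable]: "Measurable.pred M Q"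
  shows "\<P>(\<omega> in M. Q \<omega> \<and> x < X n \<omega>) = p * \<P>(\<omega> in M. Q \<omega>)"
proof -
  have h: "(\<lambda>z. of_bool (x < snd z) :: real) \<in> borel_measurable (count_space (UNIV :: nat set) \<Otimes>\<^sub>M borel)"
    by measurable
  have "integrable M (\<lambda>\<omega>. of_bool (Q \<omega>) :: real)" "integrable M (\<lambda>\<omega>. of_bool (x < snd (Z n \<omega>)) :: real)"
    by (auto intro!: integrable_const_bound[where B=1])
  note expectation_past_present(2)[OF g h G this]
  moreover have "expectation (\<lambda>\<omega>. of_bool (Q \<omega>) * of_bool (x < snd (Z n \<omega>))) = \<P>(\<omega> in M. Q \<omega> \<and> x < X n \<omega>)"
    unfolding of_bool_conj[symmetric] by (simp add: expectation_of_bool)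
  ultimately show ?thesis
    using p[of n] by (simp add: expectation_of_bool mult.commute)
qed

text \<open>
  The union bound over the served customers, evaluated by Wald's identity.
\<close>
lemma exceedance_le:
  assumes p: "\<And>n. \<P>(\<omega> in M. x < X n \<omega>) = p"
  shows "\<P>(\<omega> in M. \<exists>n. live n \<omega> \<and> x < X n \<omega>) \<le> p / (1 - r)"
proof (rule LIMSEQ_le_const2)
  let ?K = "\<lambda>n. {\<omega> \<in> space M. \<exists>i<n. live i \<omega> \<and> x < X i \<omega>}"
  have "(\<lambda>n. prob (?K n)) \<longlonglongrightarrow> prob (\<Union>n. ?K n)"
    by (rule finite_Lim_measure_incseq) (auto simp: incseq_def intro: less_le_trans)
  also have "(\<Union>n. ?K n) = {\<omega> \<in> space M. \<exists>n. live n \<omega> \<and> x < X n \<omega>}"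
    by auto
  finally show "(\<lambda>n. prob (?K n)) \<longlonglongrightarrow> \<P>(\<omega> in M. \<exists>n. live n \<omega> \<and> x < X n \<omega>)" .
  have "prob (?K n) \<le> p / (1 - r)" for n
  proof -
    have "p \<ge> 0" using p[of 0] by (metis measure_nonneg)
    have "?K n = (\<Union>i<n. {\<omega> \<in> space M. live i \<omega> \<and> x < X i \<omega>})" by auto
    also have "prob \<dots> \<le> (\<Sum>i<n. \<P>(\<omega> in M. live i \<omega> \<and> x < X i \<omega>))"
      by (rule finite_measure_subadditive_finite) auto
    also have "\<dots> = (\<Sum>i<n. p * \<P>(\<omega> in M. live i \<omega>))"
    proof (intro sum.cong refl prob_past_exceed p)
      fix i :: nat
      show "(\<lambda>z. of_bool (alive (\<lambda>j. fst (z j)) i) :: real)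
          \<in> borel_measurable (PiM {..<i} (\<lambda>_. count_space UNIV \<Otimes>\<^sub>M (borel :: real measure)))"
        using measurable_past_live[of i i] by measurable
      show "of_bool (alive (\<lambda>j. fst ((\<lambda>i\<in>{..<i}. Z i \<omega>) j)) i) = (of_bool (live i \<omega>) :: real)" for \<omega>
        by (simp only: past_live order.refl)
    qed simp
    also have "\<dots> = p * expectation (served n)"
      by (simp add: expectation_served sum_distrib_left)
    also have "\<dots> \<le> p * (1 / (1 - r))"
      by (rule mult_left_mono[OF expectation_served_le \<open>p \<ge> 0\<close>])
    finally show ?thesis by simp
  qed
  then show "\<exists>N. \<forall>n\<ge>N. prob (?K n) \<le> p / (1 - r)" by blast
qed

text \<open>
  Only the first exceedance is counted, that is, the customers up to the first one with \<open>X n > x\<close>. Compared with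
  \<open>\<sigma>\<close> this loses customers only on the event that an exceedance occurs, and by Cauchy-Schwarz
  together with \<open>exceedance_le\<close> and the second moment of \<open>\<sigma>\<close> the loss is small.
\<close>
lemma exceedance_ge:
  assumes p: "\<And>n. \<P>(\<omega> in M. x < X n \<omega>) = p"
  shows "p / (1 - r) * (1 - sqrt ((v + 1) * p) / (1 - r)) \<le> \<P>(\<omega> in M. \<exists>n. live n \<omega> \<and> x < X n \<omega>)"
proof (rule LIMSEQ_le_const2)
  let ?K = "\<lambda>\<omega>. \<exists>n. live n \<omega> \<and> x < X n \<omega>"
  let ?s = "sqrt ((v + 1) / (1 - r) ^ 3 * (p / (1 - r)))"
  let ?F = "\<lambda>i \<omega>. live i \<omega> \<and> (\<forall>j<i. X j \<omega> \<le> x)"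
  have "p \<ge> 0" using p[of 0] by (metis measure_nonneg)
  have bound: "p * (expectation (served n) - ?s) \<le> \<P>(\<omega> in M. ?K \<omega>)" for n
  proof -
    have "p * \<P>(\<omega> in M. ?F i \<omega>) = \<P>(\<omega> in M. ?F i \<omega> \<and> x < X i \<omega>)" for i
    proof (rule prob_past_exceed[OF p, symmetric])
      have "(\<lambda>z. z j) \<in> PiM {..<i} (\<lambda>_. count_space UNIV \<Otimes>\<^sub>M (borel :: real measure))
          \<rightarrow>\<^sub>M count_space (UNIV :: nat set) \<Otimes>\<^sub>M borel" if "j < i" for j
        using that by (intro measurable_component_singleton) auto
      then have "Measurable.pred (PiM {..<i} (\<lambda>_. count_space (UNIV :: nat set) \<Otimes>\<^sub>M borel))
          (\<lambda>z. snd (z j) \<le> x)" if "j < i" for j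
        using that by measurable
      then have "Measurable.pred (PiM {..<i} (\<lambda>_. count_space (UNIV :: nat set) \<Otimes>\<^sub>M borel))
          (\<lambda>z. \<forall>j\<in>{..<i}. snd (z j) \<le> x)"
        by (intro pred_intros_finite) auto
      then show "(\<lambda>z. of_bool (alive (\<lambda>j. fst (z j)) i \<and> (\<forall>j\<in>{..<i}. snd (z j) \<le> x)) :: real)
          \<in> borel_measurable (PiM {..<i} (\<lambda>_. count_space UNIV \<Otimes>\<^sub>M (borel :: real measure)))"
        using measurable_past_live[of i i] by measurable
      show "of_bool (alive (\<lambda>j. fst ((\<lambda>i\<in>{..<i}. Z i \<omega>) j)) i \<and> (\<forall>j\<in>{..<i}. snd ((\<lambda>i\<in>{..<i}. Z i \<omega>) j) \<le> x))
          = (of_bool (?F i \<omega>) :: real)" for \<omega>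
        by (subst past_live) auto
    qed measurable
    moreover have "(\<Sum>i<n. \<P>(\<omega> in M. ?F i \<omega> \<and> x < X i \<omega>)) \<le> \<P>(\<omega> in M. ?K \<omega>)"
    proof (subst finite_measure_finite_Union[symmetric])
      show "disjoint_family_on (\<lambda>i. {\<omega> \<in> space M. ?F i \<omega> \<and> x < X i \<omega>}) {..<n}"
        unfolding disjoint_family_on_def by (auto, metis linorder_neqE_nat not_less)
      show "prob (\<Union>i<n. {\<omega> \<in> space M. ?F i \<omega> \<and> x < X i \<omega>}) \<le> \<P>(\<omega> in M. ?K \<omega>)"
        by (intro finite_measure_mono) auto
    qed auto
    ultimately have "p * (\<Sum>i<n. \<P>(\<omega> in M. ?F i \<omega>)) \<le> \<P>(\<omega> in M. ?K \<omega>)"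
      by (simp add: sum_distrib_left)
    moreover have "expectation (served n) - ?s \<le> (\<Sum>i<n. \<P>(\<omega> in M. ?F i \<omega>))"
    proof -
      have cs: "integrable M (\<lambda>\<omega>. served n \<omega> * of_bool (?K \<omega>))"
        "expectation (\<lambda>\<omega>. served n \<omega> * of_bool (?K \<omega>)) \<le> sqrt (expectation (\<lambda>\<omega>. (served n \<omega>)\<^sup>2) * \<P>(\<omega> in M. ?K \<omega>))"
        using integrable_served_sq[of n] by (intro expectation_event_le_sqrt; measurable)+
      have "expectation (\<lambda>\<omega>. (served n \<omega>)\<^sup>2) * \<P>(\<omega> in M. ?K \<omega>) \<le> (v + 1) / (1 - r) ^ 3 * (p / (1 - r))"
        using expectation_served_sq_le[of n] exceedance_le[OF p] v_nonneg load
        by (intro mult_mono) auto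
      then have "expectation (served n) - ?s \<le> expectation (served n) - expectation (\<lambda>\<omega>. served n \<omega> * of_bool (?K \<omega>))"
        using cs(2) real_sqrt_le_mono by (smt (verit))
      also have "\<dots> = expectation (\<lambda>\<omega>. served n \<omega> - served n \<omega> * of_bool (?K \<omega>))"
        using cs(1) by simp
      also have "\<dots> \<le> expectation (\<lambda>\<omega>. \<Sum>i<n. of_bool (?F i \<omega>))"
      proof (rule integral_mono)
        show "integrable M (\<lambda>\<omega>. served n \<omega> - served n \<omega> * of_bool (?K \<omega>))"
          using cs(1) by simp
        show "integrable M (\<lambda>\<omega>. \<Sum>i<n. of_bool (?F i \<omega>) :: real)"
          by (intro Bochner_Integration.integrable_sum integrable_const_bound[where B=1]) auto
        show "served n \<omega> - served n \<omega> * of_bool (?K \<omega>) \<le> (\<Sum>i<n. of_bool (?F i \<omega>))" for \<omega>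
        proof (cases "?K \<omega>")
          case True
          then show ?thesis by (simp add: sum_nonneg)
        next
          case False
          \<comment> \<open>Earlier customers are served as well, so without an exceedance nothing is lost.\<close>
          then have "live i \<omega> \<Longrightarrow> ?F i \<omega>" for i
            using alive_antimono[of "\<lambda>i. A i \<omega>" i] by (meson less_imp_le not_less)
          then have "served n \<omega> \<le> (\<Sum>i<n. of_bool (?F i \<omega>))"
            unfolding served_def by (intro sum_mono) auto
          with False show ?thesis by simp
        qed
      qed
      also have "\<dots> = (\<Sum>i<n. \<P>(\<omega> in M. ?F i \<omega>))"
        by (subst Bochner_Integration.integral_sum)
           (auto simp only: expectation_of_bool intro!: integrable_const_bound[where B=1] | auto)+
      finally show ?thesis .
    qed
    ultimately show ?thesis
      using mult_left_mono \<open>p \<ge> 0\<close> by (meson order_trans)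
  qed
  then show "\<exists>N. \<forall>n\<ge>N. p * (expectation (served n) - ?s) \<le> \<P>(\<omega> in M. ?K \<omega>)" by blast
  \<comment> \<open>The cube from the second moment and the factor from the union bound combine to a fourth power.\<close>
  have "(v + 1) / (1 - r) ^ 3 * (p / (1 - r)) = ((v + 1) * p) / ((1 - r)\<^sup>2)\<^sup>2"
    by (simp add: power2_eq_square power3_eq_cube)
  then have "?s = sqrt ((v + 1) * p) / (1 - r)\<^sup>2"
    by (simp only: real_sqrt_divide real_sqrt_abs abs_power2)
  then have "p * (1 / (1 - r) - ?s) = p / (1 - r) * (1 - sqrt ((v + 1) * p) / (1 - r))"
    by (simp add: right_diff_distrib power2_eq_square)
  moreover have "(\<lambda>n. p * (expectation (served n) - ?s)) \<longlonglongrightarrow> p * (1 / (1 - r) - ?s)"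
    by (intro tendsto_intros expectation_served_tendsto)
  ultimately show "(\<lambda>n. p * (expectation (served n) - ?s)) \<longlonglongrightarrow> p / (1 - r) * (1 - sqrt ((v + 1) * p) / (1 - r))"
    by simp
qed

end

section \<open>Poisson arrivals during independent service times\<close>

abbreviation poisson_weight :: "real \<Rightarrow> nat \<Rightarrow> real" where
  "poisson_weight b k \<equiv> b ^ k / fact k * exp (- b)"

lemma poisson_weight_sums: "poisson_weight b sums 1"
proof -
  have "(\<lambda>k. b ^ k / fact k * exp (- b)) sums (exp b * exp (- b))"
    using exp_converges[of b] by (intro sums_mult2) (simp add: divide_inverse mult.commute)
  then show ?thesis by (simp flip: exp_add)
qed

lemma poisson_weight_Suc: "real (Suc k) * poisson_weight b (Suc k) = b * poisson_weight b k"
  by (simp add: field_simps del: of_nat_Suc)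

lemma poisson_mean_sums: "(\<lambda>k. real k * poisson_weight b k) sums b"
proof -
  have "(\<lambda>k. real (Suc k) * poisson_weight b (Suc k)) sums (b * 1)"
    unfolding poisson_weight_Suc by (intro sums_mult poisson_weight_sums)
  from sums_Suc[OF this] show ?thesis by simp
qed

lemma poisson_second_moment_sums: "(\<lambda>k. (real k)\<^sup>2 * poisson_weight b k) sums (b\<^sup>2 + b)"
proof -
  have "(real (Suc k))\<^sup>2 * poisson_weight b (Suc k) = b * (real k * poisson_weight b k + poisson_weight b k)" for k
  proof -
    have "(real (Suc k))\<^sup>2 * poisson_weight b (Suc k) = real (Suc k) * (b * poisson_weight b k)"
      unfolding poisson_weight_Suc[symmetric] by (simp only: power2_eq_square mult.assoc)
    also have "\<dots> = b * (real k * poisson_weight b k + poisson_weight b k)"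
      by (simp only: of_nat_Suc distrib_left distrib_right mult.assoc mult.left_commute mult_1_left add.commute)
    finally show ?thesis .
  qed
  moreover have "(\<lambda>k. b * (real k * poisson_weight b k + poisson_weight b k)) sums (b * (b + 1))"
    by (intro sums_mult sums_add poisson_mean_sums poisson_weight_sums)
  ultimately have "(\<lambda>k. (real (Suc k))\<^sup>2 * poisson_weight b (Suc k)) sums (b * (b + 1))" by simp
  from sums_Suc[OF this] show ?thesis by (simp add: power2_eq_square algebra_simps)
qed

text \<open>
  The mass that the Poisson law with mean \<open>b\<close> gives to \<open>K\<close>, written as a series so that it is visibly
  measurable in \<open>b\<close> and also makes sense for \<open>b \<le> 0\<close>.
\<close>
definition poisson_mass :: "nat set \<Rightarrow> real \<Rightarrow> ennreal" where
  "poisson_mass K b = (\<Sum>k. ennreal (poisson_weight b k) * indicator K k)"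

lemma poisson_mass_eq: "0 < b \<Longrightarrow> emeasure (measure_pmf (poisson_pmf b)) K = poisson_mass K b"
  by (simp add: poisson_mass_def nn_integral_indicator[symmetric] nn_integral_measure_pmf
      nn_integral_count_space_nat del: nn_integral_indicator)

lemma poisson_mass_UNIV: "0 < b \<Longrightarrow> poisson_mass UNIV b = 1"
  using poisson_mass_eq[of b UNIV] measure_pmf.emeasure_space_1[of "poisson_pmf b"] by simp

lemma poisson_mass_singleton: "poisson_mass {k} b = ennreal (poisson_weight b k)"
proof -
  have "(\<Sum>j. ennreal (poisson_weight b j) * indicator {k} j) = (\<Sum>j\<in>{k}. ennreal (poisson_weight b j) * indicator {k} j)"
    by (rule suminf_finite) auto
  then show ?thesis by (simp add: poisson_mass_def)
qed

lemma measurable_poisson_mass [measurable]: "poisson_mass K \<in> borel_measurable borel"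
  unfolding poisson_mass_def by measurable

text \<open>
  Evaluation of a path at a random time is not measurable on the product space of all paths. Right-continuous
  monotone paths, however, can be read off from their values at rational times: the value at \<open>t\<close> is the least of
  the values at the rationals \<open>grid k t > t\<close>, which tend to \<open>t\<close>. The resulting functional \<open>right_eval\<close> is jointly
  measurable in the path and the time, and this is what allows Fubini's theorem to be used for arrivals
  during random service times.
\<close>
definition grid :: "nat \<Rightarrow> real \<Rightarrow> real" where
  "grid k t = (real (nat \<lfloor>real (Suc k) * t\<rfloor>) + 1) / real (Suc k)"

definition right_eval :: "(real \<Rightarrow> nat) \<Rightarrow> real \<Rightarrow> nat" where
  "right_eval f t = (LEAST j. \<exists>k. f (grid k t) = j)"

lemma grid_greater: "t < grid k t"
proof -
  have "real (Suc k) * t < real (nat \<lfloor>real (Suc k) * t\<rfloor>) + 1" by linarith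
  then show ?thesis unfolding grid_def by (simp only: pos_less_divide_eq of_nat_0_less_iff zero_less_Suc mult.commute)
qed

lemma grid_le: "0 \<le> t \<Longrightarrow> grid k t \<le> t + 1 / real (Suc k)"
proof -
  assume "0 \<le> t"
  then have "0 \<le> real (Suc k) * t" by simp
  then have "real (nat \<lfloor>real (Suc k) * t\<rfloor>) + 1 \<le> real (Suc k) * t + 1" by linarith
  then have "grid k t \<le> (real (Suc k) * t + 1) / real (Suc k)"
    unfolding grid_def by (rule divide_right_mono) simp
  then show ?thesis by (simp add: add_divide_distrib del: of_nat_Suc)
qed

lemma right_eval_eq:
  assumes t: "0 \<le> t" and mono: "mono_on {0..} f" and cont: "continuous (at_right t) f"
  shows "right_eval f t = f t"
  unfolding right_eval_def
proof (rule Least_equality)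
  have "eventually (\<lambda>s. f s = f t) (at_right t)"
    using cont by (simp add: continuous_within tendsto_discrete)
  then obtain b where b: "b > t" "\<And>y. t < y \<Longrightarrow> y < b \<Longrightarrow> f y = f t"
    by (auto simp: eventually_at_right_field)
  obtain k where "1 / real (Suc k) < b - t"
    using reals_Archimedean[of "b - t"] b(1) by (auto simp: inverse_eq_divide)
  then have "grid k t < b" using grid_le[OF t, of k] by simp
  then show "\<exists>k. f (grid k t) = f t" using b(2) grid_greater by blast
next
  fix j assume "\<exists>k. f (grid k t) = j"
  then obtain k where "f (grid k t) = j" by blast
  then show "f t \<le> j"
    using mono_onD[OF mono, of t "grid k t"] t grid_greater[of t k] by auto
qed

lemma measurable_right_eval:
  assumes F: "F \<in> X \<rightarrow>\<^sub>M PiM {0..} (\<lambda>_. count_space UNIV)" and T [measurable]: "T \<in> borel_measurable X"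
  shows "(\<lambda>x. right_eval (F x) (T x)) \<in> X \<rightarrow>\<^sub>M count_space UNIV"
proof -
  have "(\<lambda>x. F x (grid k (T x))) \<in> X \<rightarrow>\<^sub>M count_space UNIV" for k
    unfolding grid_def
  proof (rule measurable_compose_countable[where f="\<lambda>m x. F x ((real m + 1) / real (Suc k))"
        and g="\<lambda>x. nat \<lfloor>real (Suc k) * T x\<rfloor>"])
    show "(\<lambda>x. F x ((real m + 1) / real (Suc k))) \<in> X \<rightarrow>\<^sub>M count_space UNIV" for m
      by (rule measurable_compose[OF F]) (auto intro: measurable_component_singleton)
    show "(\<lambda>x. nat \<lfloor>real (Suc k) * T x\<rfloor>) \<in> X \<rightarrow>\<^sub>M count_space UNIV"
      by measurable
  qed
  note [measurable] = this
  show ?thesis unfolding right_eval_def by measurable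
qed

text \<open>
  The two random elements may take values in different types, as a sequence of service times and a
  path of the arrival process do.
\<close>
lemma (in prob_space) distr_Pair_indep:
  assumes f [measurable]: "f \<in> M \<rightarrow>\<^sub>M S" and g [measurable]: "g \<in> M \<rightarrow>\<^sub>M T"
    and ind: "indep_set (sets (vimage_algebra (space M) f S)) (sets (vimage_algebra (space M) g T))"
  shows "distr M (S \<Otimes>\<^sub>M T) (\<lambda>x. (f x, g x)) = distr M S f \<Otimes>\<^sub>M distr M T g"
proof (rule pair_measure_eqI[symmetric])
  show "sigma_finite_measure (distr M S f)" "sigma_finite_measure (distr M T g)"
    by (auto intro!: prob_space_imp_sigma_finite prob_space_distr)
  show "sets (distr M S f \<Otimes>\<^sub>M distr M T g) = sets (distr M (S \<Otimes>\<^sub>M T) (\<lambda>x. (f x, g x)))"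
    by (simp cong: sets_pair_measure_cong)
  fix A B assume "A \<in> sets (distr M S f)" "B \<in> sets (distr M T g)"
  then have [measurable]: "A \<in> sets S" "B \<in> sets T" by auto
  have "prob ((f -` A \<inter> space M) \<inter> (g -` B \<inter> space M)) = prob (f -` A \<inter> space M) * prob (g -` B \<inter> space M)"
    by (rule indep_setD[OF ind]) (auto intro: in_vimage_algebra)
  moreover have "(\<lambda>x. (f x, g x)) -` (A \<times> B) \<inter> space M = (f -` A \<inter> space M) \<inter> (g -` B \<inter> space M)"
    by auto
  ultimately show "emeasure (distr M S f) A * emeasure (distr M T g) B
      = emeasure (distr M (S \<Otimes>\<^sub>M T) (\<lambda>x. (f x, g x))) (A \<times> B)"
    by (simp add: emeasure_distr emeasure_eq_measure ennreal_mult)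
qed

text \<open>
  Arrivals form a Poisson process run at speed \<open>\<rho>\<close>, independent of the service times.
\<close>
locale poisson_queue = prob_space M for M :: "'a measure" +
  fixes X :: "nat \<Rightarrow> 'a \<Rightarrow> real" and N :: "real \<Rightarrow> 'a \<Rightarrow> nat" and c \<rho> :: real
  assumes indep_X: "indep_vars (\<lambda>_. borel) X UNIV"
    and X_pos: "\<And>i. AE \<omega> in M. 0 < X i \<omega>"
    and poisson: "poisson_process M c N"
    and indep_XN: "indep_set
        (sets (vimage_algebra (space M) (\<lambda>\<omega>. \<lambda>i\<in>UNIV. X i \<omega>) (PiM UNIV (\<lambda>_. borel))))
        (sets (vimage_algebra (space M) (\<lambda>\<omega>. \<lambda>t\<in>{0..}. N t \<omega>) (PiM {0..} (\<lambda>_. count_space UNIV))))"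
    and c_pos: "0 < c" and rho_pos: "0 < \<rho>"
begin

definition work :: "nat \<Rightarrow> 'a \<Rightarrow> real" where
  "work n \<omega> = (\<Sum>i<n. X i \<omega>)"

text \<open>
  On the probability space, \<open>right_eval\<close> of a path is its value; the detour makes \<open>arrivals\<close> a measurable functional
  of the service times and the path.
\<close>
definition arrivals :: "nat \<Rightarrow> 'a \<Rightarrow> nat" where
  "arrivals i \<omega> = right_eval (\<lambda>t\<in>{0..}. N t \<omega>) (\<rho> * work (Suc i) \<omega>) - right_eval (\<lambda>t\<in>{0..}. N t \<omega>) (\<rho> * work i \<omega>)"

lemma measurable_X [measurable]: "X i \<in> borel_measurable M"
  using indep_X by (auto simp: indep_vars_def)

lemma AE_X_pos: "AE \<omega> in M. \<forall>i. 0 < X i \<omega>"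
  using X_pos by (simp add: AE_all_countable)

lemma measurable_work [measurable]: "work n \<in> borel_measurable M"
  unfolding work_def[abs_def] by measurable

lemma measurable_N: "0 \<le> t \<Longrightarrow> N t \<in> M \<rightarrow>\<^sub>M count_space UNIV"
  using poisson by (auto simp: poisson_process_def)

lemma measurable_X_path: "(\<lambda>\<omega>. \<lambda>i\<in>UNIV. X i \<omega>) \<in> M \<rightarrow>\<^sub>M PiM UNIV (\<lambda>_. borel)"
  by (rule measurable_restrict) simp

lemma measurable_N_path: "(\<lambda>\<omega>. \<lambda>t\<in>{0..}. N t \<omega>) \<in> M \<rightarrow>\<^sub>M PiM {0..} (\<lambda>_. count_space UNIV)"
  by (rule measurable_restrict) (simp add: measurable_N)

lemma measurable_arrivals [measurable]: "arrivals i \<in> M \<rightarrow>\<^sub>M count_space UNIV"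
proof -
  note [measurable] = measurable_right_eval[OF measurable_N_path]
  show ?thesis unfolding arrivals_def[abs_def] by measurable
qed

lemma right_eval_N:
  assumes "\<omega> \<in> space M" "0 \<le> t"
  shows "right_eval (\<lambda>t\<in>{0..}. N t \<omega>) t = N t \<omega>"
proof -
  have "mono_on {0..} (\<lambda>t. N t \<omega>)" and cont: "continuous (at_right t) (\<lambda>s. N s \<omega>)"
    using assms poisson by (auto simp: poisson_process_def)
  then have "mono_on {0..} (\<lambda>t\<in>{0..}. N t \<omega>)"
    by (auto simp: mono_on_def)
  moreover have "continuous (at_right t) (\<lambda>t\<in>{0..}. N t \<omega>)"
  proof -
    have "eventually (\<lambda>s. N s \<omega> = (\<lambda>t\<in>{0..}. N t \<omega>) s) (at_right t)"
      using assms(2) by (auto simp: eventually_at_right_field intro!: exI[of _ "t + 1"])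
    then show ?thesis
      using cont assms(2) unfolding continuous_within
      by (auto elim: Lim_transform_eventually)
  qed
  ultimately show ?thesis
    using right_eval_eq[OF assms(2), of "\<lambda>t\<in>{0..}. N t \<omega>"] assms(2) by simp
qed

text \<open>
  For deterministic service times the arrivals are increments of the Poisson process over adjacent intervals.
\<close>
lemma prob_increments:
  fixes b :: "nat \<Rightarrow> real"
  assumes b: "\<And>i. 0 < b i" and n: "0 < n"
  shows "emeasure M {\<omega> \<in> space M. \<forall>i<n. N (\<rho> * (\<Sum>j<Suc i. b j)) \<omega> - N (\<rho> * (\<Sum>j<i. b j)) \<omega> \<in> K i}
    = (\<Prod>i<n. poisson_mass (K i) (c * (\<rho> * b i)))"
proof -
  let ?t = "\<lambda>i. \<rho> * (\<Sum>j<i. b j)"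
  let ?I = "\<lambda>i \<omega>. N (?t (Suc i)) \<omega> - N (?t i) \<omega>"
  have t_pos: "0 \<le> ?t i" for i
    using b rho_pos by (intro mult_nonneg_nonneg sum_nonneg) (auto intro: less_imp_le)
  have t_less: "?t i < ?t (Suc i)" for i
    using b[of i] rho_pos by (simp add: distrib_left)
  have [measurable]: "N (?t i) \<in> M \<rightarrow>\<^sub>M count_space UNIV" for i
    by (rule measurable_N[OF t_pos])
  have ind: "indep_vars (\<lambda>_. count_space UNIV) ?I {..<n}"
    by (rule poisson[unfolded poisson_process_def, THEN conjunct2, THEN conjunct2, THEN conjunct2,
          rule_format, of ?t n]) (use t_pos[of 0] less_imp_le[OF t_less] in auto)
  have single: "emeasure M (?I i -` K i \<inter> space M) = poisson_mass (K i) (c * (\<rho> * b i))" for i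
  proof -
    have "distr M (count_space UNIV) (?I i) = measure_pmf (poisson_pmf (c * (?t (Suc i) - ?t i)))"
      by (rule poisson[unfolded poisson_process_def, THEN conjunct2, THEN conjunct2, THEN conjunct1,
            rule_format]) (use t_pos[of i] t_less[of i] in blast)
    moreover have "?t (Suc i) - ?t i = \<rho> * b i"
      by (simp add: algebra_simps)
    ultimately have "emeasure (distr M (count_space UNIV) (?I i)) (K i) = poisson_mass (K i) (c * (\<rho> * b i))"
      using poisson_mass_eq[of "c * (\<rho> * b i)" "K i"] c_pos rho_pos b[of i] by simp
    then show ?thesis
      by (subst (asm) emeasure_distr) (auto simp del: sum.lessThan_Suc)
  qed
  have "{..<n} \<noteq> {}"
    using n by auto
  then have "{\<omega> \<in> space M. \<forall>i<n. ?I i \<omega> \<in> K i} = (\<Inter>i\<in>{..<n}. ?I i -` K i \<inter> space M)"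
    by (auto simp del: sum.lessThan_Suc)
  then have "emeasure M {\<omega> \<in> space M. \<forall>i<n. ?I i \<omega> \<in> K i} = (\<Prod>i<n. emeasure M (?I i -` K i \<inter> space M))"
    using indep_varsD_finite[OF ind \<open>{..<n} \<noteq> {}\<close>, of K]
    by (simp add: emeasure_eq_measure prod_ennreal del: sum.lessThan_Suc)
  then show ?thesis using single by simp
qed

text \<open>
  By Fubini's theorem the service times may be fixed while the arrival process is averaged out; the
  result is a product over \<open>i\<close> of functions of \<open>X i\<close>, whose expectation factorises by the independence of
  the service times.
\<close>
lemma prob_pairs:
  fixes K :: "nat \<Rightarrow> nat set" and D :: "nat \<Rightarrow> real set"
  assumes D [measurable]: "\<And>i. D i \<in> sets borel" and n: "0 < n"
  shows "emeasure M {\<omega> \<in> space M. \<forall>i<n. arrivals i \<omega> \<in> K i \<and> X i \<omega> \<in> D i}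
    = (\<Prod>i<n. \<integral>\<^sup>+\<omega>. indicator (D i) (X i \<omega>) * poisson_mass (K i) (c * (\<rho> * X i \<omega>)) \<partial>M)"
proof -
  let ?PB = "PiM UNIV (\<lambda>_. borel) :: (nat \<Rightarrow> real) measure"
  let ?PN = "PiM {0..} (\<lambda>_. count_space UNIV) :: (real \<Rightarrow> nat) measure"
  let ?Xf = "\<lambda>\<omega>. \<lambda>i\<in>UNIV. X i \<omega>" and ?Nf = "\<lambda>\<omega>. \<lambda>t\<in>{0..}. N t \<omega>"
  have [measurable]: "?Xf \<in> M \<rightarrow>\<^sub>M ?PB" "?Nf \<in> M \<rightarrow>\<^sub>M ?PN"
    by (rule measurable_X_path measurable_N_path)+
  define inc where "inc i z = right_eval (snd z) (\<rho> * (\<Sum>j<Suc i. fst z j)) - right_eval (snd z) (\<rho> * (\<Sum>j<i. fst z j))"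
    for i and z :: "(nat \<Rightarrow> real) \<times> (real \<Rightarrow> nat)"
  have [measurable]: "(\<lambda>z. right_eval (snd z) (\<rho> * (\<Sum>j<i. fst z j))) \<in> ?PB \<Otimes>\<^sub>M ?PN \<rightarrow>\<^sub>M count_space UNIV" for i
    by (rule measurable_right_eval) measurable
  have [measurable]: "inc i \<in> ?PB \<Otimes>\<^sub>M ?PN \<rightarrow>\<^sub>M count_space UNIV" for i
    unfolding inc_def[abs_def] by measurable
  define E where "E = {z \<in> space (?PB \<Otimes>\<^sub>M ?PN). \<forall>i<n. inc i z \<in> K i \<and> fst z i \<in> D i}"
  have E [measurable]: "E \<in> sets (?PB \<Otimes>\<^sub>M ?PN)"
    unfolding E_def by measurable
  interpret DN: prob_space "distr M ?PN ?Nf" by (rule prob_space_distr) simp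
  have "{\<omega> \<in> space M. \<forall>i<n. arrivals i \<omega> \<in> K i \<and> X i \<omega> \<in> D i} = (\<lambda>\<omega>. (?Xf \<omega>, ?Nf \<omega>)) -` E \<inter> space M"
    unfolding E_def by (auto simp: arrivals_def inc_def work_def space_pair_measure space_PiM)
  then have "emeasure M {\<omega> \<in> space M. \<forall>i<n. arrivals i \<omega> \<in> K i \<and> X i \<omega> \<in> D i}
      = emeasure (distr M (?PB \<Otimes>\<^sub>M ?PN) (\<lambda>\<omega>. (?Xf \<omega>, ?Nf \<omega>))) E"
    by (subst emeasure_distr) auto
  also have "distr M (?PB \<Otimes>\<^sub>M ?PN) (\<lambda>\<omega>. (?Xf \<omega>, ?Nf \<omega>)) = distr M ?PB ?Xf \<Otimes>\<^sub>M distr M ?PN ?Nf"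
    by (rule distr_Pair_indep[OF measurable_X_path measurable_N_path indep_XN])
  also have "emeasure \<dots> E = (\<integral>\<^sup>+b. emeasure (distr M ?PN ?Nf) (Pair b -` E) \<partial>distr M ?PB ?Xf)"
    by (rule DN.emeasure_pair_measure_alt) simp
  also have "\<dots> = (\<integral>\<^sup>+\<omega>. emeasure (distr M ?PN ?Nf) (Pair (?Xf \<omega>) -` E) \<partial>M)"
    using DN.measurable_emeasure_Pair[of E ?PB] by (intro nn_integral_distr) auto
  also have "\<dots> = (\<integral>\<^sup>+\<omega>. (\<Prod>i<n. indicator (D i) (X i \<omega>) * poisson_mass (K i) (c * (\<rho> * X i \<omega>))) \<partial>M)"
  proof (rule nn_integral_cong_AE)
    show "AE \<omega> in M. emeasure (distr M ?PN ?Nf) (Pair (?Xf \<omega>) -` E) =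
        (\<Prod>i<n. indicator (D i) (X i \<omega>) * poisson_mass (K i) (c * (\<rho> * X i \<omega>)))"
      using AE_X_pos
    proof eventually_elim
      case (elim \<omega>)
      have nonneg: "0 \<le> \<rho> * (\<Sum>j<i. X j \<omega>)" for i
        using elim rho_pos by (intro mult_nonneg_nonneg sum_nonneg) (auto intro: less_imp_le)
      have "emeasure (distr M ?PN ?Nf) (Pair (?Xf \<omega>) -` E) = emeasure M (?Nf -` (Pair (?Xf \<omega>) -` E) \<inter> space M)"
        by (rule emeasure_distr) auto
      \<comment> \<open>The condition on the fixed service time is absorbed into the set of admissible arrival counts,
          which is emptied if the condition fails.\<close>
      also have "?Nf -` (Pair (?Xf \<omega>) -` E) \<inter> space M = {\<omega>' \<in> space M. \<forall>i<n.
          N (\<rho> * (\<Sum>j<Suc i. X j \<omega>)) \<omega>' - N (\<rho> * (\<Sum>j<i. X j \<omega>)) \<omega>' \<in> (if X i \<omega> \<in> D i then K i else {})}"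
        using nonneg by (auto simp: E_def inc_def space_pair_measure space_PiM right_eval_N simp del: sum.lessThan_Suc split: if_splits)
      also have "emeasure M \<dots> = (\<Prod>i<n. poisson_mass (if X i \<omega> \<in> D i then K i else {}) (c * (\<rho> * X i \<omega>)))"
        using elim by (intro prob_increments n) auto
      also have "\<dots> = (\<Prod>i<n. indicator (D i) (X i \<omega>) * poisson_mass (K i) (c * (\<rho> * X i \<omega>)))"
        by (intro prod.cong) (auto simp: poisson_mass_def)
      finally show ?case .
    qed
  qed
  also have "\<dots> = (\<Prod>i<n. \<integral>\<^sup>+\<omega>. indicator (D i) (X i \<omega>) * poisson_mass (K i) (c * (\<rho> * X i \<omega>)) \<partial>M)"
  proof (rule indep_vars_nn_integral)
    have "indep_vars (\<lambda>_. borel) X {..<n}"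
      by (rule indep_vars_subset[OF indep_X]) auto
    then show "indep_vars (\<lambda>_. borel) (\<lambda>i \<omega>. indicator (D i) (X i \<omega>) * poisson_mass (K i) (c * (\<rho> * X i \<omega>))) {..<n}"
      by (rule indep_vars_compose2[where Y="\<lambda>i x. indicator (D i) x * poisson_mass (K i) (c * (\<rho> * x))"]) measurable
  qed auto
  finally show ?thesis .
qed

text \<open>
  The case of a single index, obtained by imposing no condition on the earlier pairs.
\<close>
lemma prob_pair:
  assumes "D \<in> sets borel"
  shows "emeasure M {\<omega> \<in> space M. arrivals i \<omega> \<in> K \<and> X i \<omega> \<in> D}
    = (\<integral>\<^sup>+\<omega>. indicator D (X i \<omega>) * poisson_mass K (c * (\<rho> * X i \<omega>)) \<partial>M)"
proof -
  have *: "emeasure M {\<omega> \<in> space M. \<forall>j<Suc i. arrivals j \<omega> \<in> (if j = i then K else UNIV) \<and> X j \<omega> \<in> (if j = i then D else UNIV)}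
    = (\<Prod>j<Suc i. \<integral>\<^sup>+\<omega>. indicator (if j = i then D else UNIV) (X j \<omega>)
        * poisson_mass (if j = i then K else UNIV) (c * (\<rho> * X j \<omega>)) \<partial>M)"
    using assms by (intro prob_pairs) auto
  have "(\<integral>\<^sup>+\<omega>. indicator UNIV (X j \<omega>) * poisson_mass UNIV (c * (\<rho> * X j \<omega>)) \<partial>M) = (\<integral>\<^sup>+\<omega>. 1 \<partial>M)" for j
    using X_pos[of j] c_pos rho_pos by (intro nn_integral_cong_AE) (auto simp: poisson_mass_UNIV)
  then have "(\<Prod>j<i. \<integral>\<^sup>+\<omega>. indicator (if j = i then D else UNIV) (X j \<omega>)
        * poisson_mass (if j = i then K else UNIV) (c * (\<rho> * X j \<omega>)) \<partial>M) = 1"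
    by (intro prod.neutral) (auto simp: emeasure_space_1)
  moreover have "{\<omega> \<in> space M. \<forall>j<Suc i. arrivals j \<omega> \<in> (if j = i then K else UNIV) \<and> X j \<omega> \<in> (if j = i then D else UNIV)}
      = {\<omega> \<in> space M. arrivals i \<omega> \<in> K \<and> X i \<omega> \<in> D}"
    by auto
  ultimately show ?thesis using * by simp
qed

lemma indep_pairs: "indep_vars (\<lambda>_. count_space UNIV \<Otimes>\<^sub>M borel) (\<lambda>i \<omega>. (arrivals i \<omega>, X i \<omega>)) UNIV"
proof -
  let ?E = "{a \<times> b | a b. a \<in> sets (count_space (UNIV :: nat set)) \<and> b \<in> sets (borel :: real measure)}"
  let ?Z = "\<lambda>i \<omega>. (arrivals i \<omega>, X i \<omega>)"
  have ind: "indep_vars (\<lambda>_. count_space UNIV \<Otimes>\<^sub>M borel) ?Z {..<n}" if n: "0 < n" for n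
  proof (subst indep_vars_finite[where E="\<lambda>_. ?E"])
    show "Int_stable ?E"
    proof (rule Int_stableI, safe)
      fix a c :: "nat set" and b d :: "real set"
      assume "b \<in> sets borel" "d \<in> sets borel"
      then show "\<exists>a' b'. a \<times> b \<inter> c \<times> d = a' \<times> b' \<and> a' \<in> sets (count_space UNIV) \<and> b' \<in> sets borel"
        by (intro exI[of _ "a \<inter> c"] exI[of _ "b \<inter> d"]) auto
    qed
    show "sets (count_space UNIV \<Otimes>\<^sub>M borel) = sigma_sets (space (count_space UNIV \<Otimes>\<^sub>M borel)) ?E"
      by (simp add: sets_pair_measure space_pair_measure)
    show "space (count_space UNIV \<Otimes>\<^sub>M borel) \<in> ?E"
      by (auto simp: space_pair_measure intro!: exI[of _ UNIV])
    show "\<forall>A\<in>{..<n} \<rightarrow> ?E. prob (\<Inter>j\<in>{..<n}. ?Z j -` A j \<inter> space M) = (\<Prod>j\<in>{..<n}. prob (?Z j -` A j \<inter> space M))"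
    proof
      fix A assume "A \<in> {..<n} \<rightarrow> ?E"
      then have "\<forall>i. \<exists>a b. i < n \<longrightarrow> A i = a \<times> b \<and> b \<in> sets borel"
        by (fastforce simp: Pi_iff)
      then obtain K D where KD: "\<And>i. i < n \<Longrightarrow> A i = K i \<times> D i" "\<And>i. i < n \<Longrightarrow> D i \<in> sets borel"
        by metis
      define D' where "D' i = (if i < n then D i else UNIV)" for i
      have D': "D' i \<in> sets borel" for i using KD(2) by (auto simp: D'_def)
      have "(\<Inter>j\<in>{..<n}. ?Z j -` A j \<inter> space M) = {\<omega> \<in> space M. \<forall>i<n. arrivals i \<omega> \<in> K i \<and> X i \<omega> \<in> D' i}"
        using n KD(1) by (auto simp: D'_def)
      then have "emeasure M (\<Inter>j\<in>{..<n}. ?Z j -` A j \<inter> space M)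
          = (\<Prod>i<n. emeasure M {\<omega> \<in> space M. arrivals i \<omega> \<in> K i \<and> X i \<omega> \<in> D' i})"
        using prob_pairs[OF D' n, where K=K] prob_pair[OF D', where K="K _"] by simp
      also have "\<dots> = (\<Prod>i<n. emeasure M (?Z i -` A i \<inter> space M))"
        using KD(1) by (intro prod.cong refl arg_cong[where f="emeasure M"]) (auto simp: D'_def)
      finally show "prob (\<Inter>j\<in>{..<n}. ?Z j -` A j \<inter> space M) = (\<Prod>j\<in>{..<n}. prob (?Z j -` A j \<inter> space M))"
        by (simp add: emeasure_eq_measure prod_ennreal prod_nonneg)
    qed
  qed (use n in \<open>auto intro: measurable_Pair simp: space_pair_measure\<close>)
  have "indep_sets (\<lambda>i. {?Z i -` A \<inter> space M | A. A \<in> sets (count_space UNIV \<Otimes>\<^sub>M borel)}) UNIV"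
  proof (subst indep_sets_finite_index_sets, intro allI impI)
    fix J :: "nat set" assume "finite J" "J \<noteq> {}"
    then obtain n where n: "0 < n" "J \<subseteq> {..<n}"
      by (metis finite_nat_iff_bounded lessThan_empty_iff neq0_conv subset_empty lessThan_0)
    have "indep_sets (\<lambda>i. {?Z i -` A \<inter> space M | A. A \<in> sets (count_space UNIV \<Otimes>\<^sub>M borel)}) {..<n}"
      using ind[OF n(1)] unfolding indep_vars_def2 by simp
    then show "indep_sets (\<lambda>i. {?Z i -` A \<inter> space M | A. A \<in> sets (count_space UNIV \<Otimes>\<^sub>M borel)}) J"
      by (rule indep_sets_mono_index[OF n(2)])
  qed
  then show ?thesis
    unfolding indep_vars_def2 by (auto intro: measurable_Pair)
qed

text \<open>
  Given \<open>X i\<close>, the variable \<open>arrivals i\<close> has the Poisson law with mean \<open>c * \<rho> * X i\<close>.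
\<close>
lemma nn_integral_arrivals:
  fixes g :: "nat \<Rightarrow> ennreal"
  shows "(\<integral>\<^sup>+\<omega>. g (arrivals i \<omega>) \<partial>M) = (\<integral>\<^sup>+\<omega>. (\<Sum>k. g k * ennreal (poisson_weight (c * (\<rho> * X i \<omega>)) k)) \<partial>M)"
proof -
  have [measurable]: "(\<lambda>\<omega>. f (arrivals i \<omega>)) \<in> borel_measurable M" for f :: "nat \<Rightarrow> ennreal"
    by (rule measurable_compose[OF measurable_arrivals]) simp
  have single: "(\<Sum>k. g k * indicator {k} a) = g a" for a
    by (subst suminf_finite[of "{a}"]) auto
  have "emeasure M (arrivals i -` {k} \<inter> space M) = (\<integral>\<^sup>+\<omega>. ennreal (poisson_weight (c * (\<rho> * X i \<omega>)) k) \<partial>M)" for k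
    using prob_pair[of UNIV i "{k}"] by (simp add: poisson_mass_singleton vimage_def Int_def conj_commute)
  moreover have "(\<integral>\<^sup>+\<omega>. indicator {k} (arrivals i \<omega>) \<partial>M) = emeasure M (arrivals i -` {k} \<inter> space M)" for k
  proof -
    have "(\<integral>\<^sup>+\<omega>. indicator {k} (arrivals i \<omega>) \<partial>M) = (\<integral>\<^sup>+\<omega>. indicator (arrivals i -` {k} \<inter> space M) \<omega> \<partial>M)"
      by (intro nn_integral_cong) (auto split: split_indicator)
    also have "\<dots> = emeasure M (arrivals i -` {k} \<inter> space M)"
      by (rule nn_integral_indicator) measurable
    finally show ?thesis .
  qed
  ultimately have law: "(\<integral>\<^sup>+\<omega>. indicator {k} (arrivals i \<omega>) \<partial>M) = (\<integral>\<^sup>+\<omega>. ennreal (poisson_weight (c * (\<rho> * X i \<omega>)) k) \<partial>M)" for k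
    by simp
  have "(\<integral>\<^sup>+\<omega>. g (arrivals i \<omega>) \<partial>M) = (\<integral>\<^sup>+\<omega>. (\<Sum>k. g k * indicator {k} (arrivals i \<omega>)) \<partial>M)"
    by (simp add: single)
  also have "\<dots> = (\<Sum>k. \<integral>\<^sup>+\<omega>. g k * indicator {k} (arrivals i \<omega>) \<partial>M)"
    by (rule nn_integral_suminf) simp
  also have "\<dots> = (\<Sum>k. \<integral>\<^sup>+\<omega>. g k * ennreal (poisson_weight (c * (\<rho> * X i \<omega>)) k) \<partial>M)"
  proof (intro suminf_cong)
    show "(\<integral>\<^sup>+\<omega>. g k * indicator {k} (arrivals i \<omega>) \<partial>M)
        = (\<integral>\<^sup>+\<omega>. g k * ennreal (poisson_weight (c * (\<rho> * X i \<omega>)) k) \<partial>M)" for k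
      by (subst nn_integral_cmult, measurable, subst nn_integral_cmult, measurable, simp only: law)
  qed
  also have "\<dots> = (\<integral>\<^sup>+\<omega>. (\<Sum>k. g k * ennreal (poisson_weight (c * (\<rho> * X i \<omega>)) k)) \<partial>M)"
    by (rule nn_integral_suminf[symmetric]) measurable
  finally show ?thesis .
qed

lemma has_moment_arrivals:
  assumes sums: "\<And>b. (\<lambda>k. g k * poisson_weight b k) sums G b" and g: "\<And>k. 0 \<le> g k"
    and int: "integrable M (\<lambda>\<omega>. G (c * (\<rho> * X i \<omega>)))"
  shows "integrable M (\<lambda>\<omega>. g (arrivals i \<omega>))"
    and "expectation (\<lambda>\<omega>. g (arrivals i \<omega>)) = expectation (\<lambda>\<omega>. G (c * (\<rho> * X i \<omega>)))"
proof -
  have AE: "AE \<omega> in M. 0 \<le> G (c * (\<rho> * X i \<omega>)) \<and>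
      (\<Sum>k. ennreal (g k) * ennreal (poisson_weight (c * (\<rho> * X i \<omega>)) k)) = ennreal (G (c * (\<rho> * X i \<omega>)))"
    using X_pos[of i]
  proof eventually_elim
    case (elim \<omega>)
    define l where "l = c * (\<rho> * X i \<omega>)"
    have l: "0 \<le> l" using elim c_pos rho_pos by (simp add: l_def)
    have nonneg: "0 \<le> g k * poisson_weight l k" for k
      using l g[of k] by simp
    have "(\<Sum>k. ennreal (g k) * ennreal (poisson_weight l k)) = (\<Sum>k. ennreal (g k * poisson_weight l k))"
      using l g by (intro suminf_cong ennreal_mult[symmetric]) auto
    also have "\<dots> = ennreal (G l)"
      by (rule suminf_ennreal_eq[OF nonneg sums])
    finally show ?case
      using sums_le[OF nonneg sums_zero sums] unfolding l_def by blast
  qed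
  have "(\<integral>\<^sup>+\<omega>. ennreal (g (arrivals i \<omega>)) \<partial>M) = (\<integral>\<^sup>+\<omega>. ennreal (G (c * (\<rho> * X i \<omega>))) \<partial>M)"
    unfolding nn_integral_arrivals[of "\<lambda>k. ennreal (g k)"] using AE by (intro nn_integral_cong_AE) auto
  also have "\<dots> = ennreal (expectation (\<lambda>\<omega>. G (c * (\<rho> * X i \<omega>))))"
    using AE by (intro nn_integral_eq_integral int) auto
  finally have *: "(\<integral>\<^sup>+\<omega>. ennreal (g (arrivals i \<omega>)) \<partial>M) = ennreal (expectation (\<lambda>\<omega>. G (c * (\<rho> * X i \<omega>))))" .
  have nonneg: "0 \<le> expectation (\<lambda>\<omega>. G (c * (\<rho> * X i \<omega>)))"
    using AE by (intro integral_nonneg_AE) auto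
  show "integrable M (\<lambda>\<omega>. g (arrivals i \<omega>))"
    by (rule integrableI_nn_integral_finite[OF _ _ *]) (auto simp: g)
  show "expectation (\<lambda>\<omega>. g (arrivals i \<omega>)) = expectation (\<lambda>\<omega>. G (c * (\<rho> * X i \<omega>)))"
    using * nonneg g by (subst integral_eq_nn_integral) auto
qed

text \<open>
  The mixed Poisson law has mean \<open>\<rho>\<close> and second moment \<open>c\<^sup>2 m \<rho>\<^sup>2 + \<rho>\<close>. The bound on the variance is
  chosen so that it does not depend on \<open>\<rho>\<close>.
\<close>
lemma iid_queue_arrivals:
  assumes X_sq: "\<And>i. integrable M (\<lambda>\<omega>. (X i \<omega>)\<^sup>2)"
    and X_mean: "\<And>i. c * expectation (X i) = 1"
    and X_second: "\<And>i. expectation (\<lambda>\<omega>. (X i \<omega>)\<^sup>2) = m"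
    and rho: "\<rho> < 1"
  shows "iid_queue M arrivals X \<rho> (1 + c\<^sup>2 * m)"
proof
  show "indep_vars (\<lambda>_. count_space UNIV \<Otimes>\<^sub>M borel) (\<lambda>i \<omega>. (arrivals i \<omega>, X i \<omega>)) UNIV"
    by (rule indep_pairs)
  fix i
  have X_int: "integrable M (X i)"
    by (rule square_integrable_imp_integrable[OF _ X_sq]) simp
  have "expectation (\<lambda>\<omega>. real (arrivals i \<omega>)) = expectation (\<lambda>\<omega>. c * (\<rho> * X i \<omega>))"
    using X_int by (intro has_moment_arrivals poisson_mean_sums) auto
  also have "\<dots> = \<rho> * (c * expectation (X i))" by simp
  finally show mean: "expectation (\<lambda>\<omega>. real (arrivals i \<omega>)) = \<rho>"
    using X_mean by simp
  have G: "(c * (\<rho> * X i \<omega>))\<^sup>2 + c * (\<rho> * X i \<omega>) = (c\<^sup>2 * \<rho>\<^sup>2) * (X i \<omega>)\<^sup>2 + c * (\<rho> * X i \<omega>)" for \<omega>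
    by (simp add: power_mult_distrib mult.assoc)
  have int: "integrable M (\<lambda>\<omega>. (c * (\<rho> * X i \<omega>))\<^sup>2 + c * (\<rho> * X i \<omega>))"
    unfolding G using X_int X_sq by simp
  note second = has_moment_arrivals[where g="\<lambda>k. (real k)\<^sup>2", OF poisson_second_moment_sums _ int]
  show sq: "integrable M (\<lambda>\<omega>. (real (arrivals i \<omega>))\<^sup>2)"
    using second(1) by simp
  have "expectation (\<lambda>\<omega>. (real (arrivals i \<omega>))\<^sup>2) = (c\<^sup>2 * \<rho>\<^sup>2) * m + \<rho> * (c * expectation (X i))"
    using second(2) X_int X_sq X_second unfolding G by simp
  then have "expectation (\<lambda>\<omega>. (real (arrivals i \<omega>))\<^sup>2) = (c\<^sup>2 * m) * \<rho>\<^sup>2 + \<rho>"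
    using X_mean by (simp add: mult_ac)
  moreover have "expectation (\<lambda>\<omega>. (real (arrivals i \<omega>) - \<rho>)\<^sup>2) = expectation (\<lambda>\<omega>. (real (arrivals i \<omega>))\<^sup>2) - \<rho>\<^sup>2"
    using variance_eq[OF square_integrable_imp_integrable[OF _ sq] sq] unfolding mean by measurable
  moreover have "(c\<^sup>2 * m) * \<rho>\<^sup>2 \<le> (c\<^sup>2 * m) * 1"
  proof (rule mult_left_mono)
    show "\<rho>\<^sup>2 \<le> 1" using rho rho_pos by (simp add: power_le_one)
    have "0 \<le> m" using X_second[of 0] by (metis Bochner_Integration.integral_nonneg zero_le_power2)
    then show "0 \<le> c\<^sup>2 * m" by simp
  qed
  ultimately show "expectation (\<lambda>\<omega>. (real (arrivals i \<omega>) - \<rho>)\<^sup>2) \<le> 1 + c\<^sup>2 * m"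
    using rho zero_le_power2[of \<rho>] by linarith
qed (rule rho)

end

section \<open>The largest jump in terms of the queue\<close>

lemma workload_eq: "workload Bs N \<rho> t \<omega> = (\<Sum>i<Suc (N (\<rho> * t) \<omega>). Bs i \<omega>) - t"
  unfolding workload_def sum.lessThan_Suc_shift by (simp add: sum.atLeast1_atMost_eq)

text \<open>
  A zero of the workload at time \<open>t\<close> means that \<open>t\<close> is the total work of all customers who arrived up to \<open>t\<close>. So the only
  candidates for \<open>\<tau>\<close> are the partial sums \<open>S m\<close>, and \<open>S m\<close> is the first zero for the least \<open>m \<ge> 1\<close> such that fewer than
  \<open>m\<close> customers have arrived in addition to customer \<open>0\<close> by then.
\<close>
lemma index_before_hitting_iff:
  assumes pos: "\<And>i. 0 < Bs i \<omega>" and mono: "mono_on {0..} (\<lambda>t. N t \<omega>)" and rho: "0 < \<rho>"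
  shows "(\<exists>t\<ge>0. ereal t \<le> hitting_time Bs N \<rho> \<omega> \<and> n \<le> N (\<rho> * t) \<omega>)
    \<longleftrightarrow> (\<forall>m\<in>{1..n}. m \<le> N (\<rho> * (\<Sum>i<m. Bs i \<omega>)) \<omega>)"
proof -
  let ?S = "\<lambda>m. \<Sum>i<m. Bs i \<omega>"
  have S_nonneg: "0 \<le> ?S m" for m
    using pos by (intro sum_nonneg) (auto intro: less_imp_le)
  have S_mono: "m \<le> k \<Longrightarrow> ?S m \<le> ?S k" for m k
    using pos by (intro sum_mono2) (auto intro: less_imp_le)
  have N_mono: "0 \<le> s \<Longrightarrow> s \<le> t \<Longrightarrow> N (\<rho> * s) \<omega> \<le> N (\<rho> * t) \<omega>" for s t
    using mono rho by (auto simp: mono_on_def)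
  show ?thesis
  proof safe
    fix t m assume t: "0 \<le> t" "ereal t \<le> hitting_time Bs N \<rho> \<omega>" "n \<le> N (\<rho> * t) \<omega>" and m: "m \<in> {1..n}"
    show "m \<le> N (\<rho> * ?S m) \<omega>"
    proof (rule ccontr)
      assume neg: "\<not> m \<le> N (\<rho> * ?S m) \<omega>"
      define k where "k = (LEAST k. N (\<rho> * ?S k) \<omega> < k)"
      have k: "N (\<rho> * ?S k) \<omega> < k" and least: "\<And>j. j < k \<Longrightarrow> j \<le> N (\<rho> * ?S j) \<omega>" and "k \<le> m"
        using neg LeastI[of "\<lambda>k. N (\<rho> * ?S k) \<omega> < k" m] not_less_Least[of _ "\<lambda>k. N (\<rho> * ?S k) \<omega> < k"]
          Least_le[of "\<lambda>k. N (\<rho> * ?S k) \<omega> < k" m]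
        unfolding k_def by (auto simp: not_less)
      obtain j where j: "k = Suc j" using k by (cases k) auto
      \<comment> \<open>By minimality exactly \<open>j\<close> customers have arrived at time \<open>?S k\<close>, so this is a zero.\<close>
      have "j \<le> N (\<rho> * ?S k) \<omega>"
        using least[of j] N_mono[OF S_nonneg S_mono, of j k] j by simp
      then have "N (\<rho> * ?S k) \<omega> = j" using k j by simp
      then have "workload Bs N \<rho> (?S k) \<omega> = 0"
        by (simp add: workload_eq j)
      then have "hitting_time Bs N \<rho> \<omega> \<le> ereal (?S k)"
        unfolding hitting_time_def using S_nonneg by (intro Inf_lower) auto
      then have "t \<le> ?S k" using t(2) by (metis order_trans ereal_less_eq(3))
      then have "n \<le> N (\<rho> * ?S k) \<omega>" using t N_mono by (meson order_trans)
      then show False using k \<open>k \<le> m\<close> m by simp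
    qed
  next
    assume alive: "\<forall>m\<in>{1..n}. m \<le> N (\<rho> * ?S m) \<omega>"
    have "ereal (?S n) \<le> hitting_time Bs N \<rho> \<omega>"
      unfolding hitting_time_def
    proof (rule Inf_greatest)
      fix z assume "z \<in> ereal ` {t. 0 \<le> t \<and> workload Bs N \<rho> t \<omega> = 0}"
      then obtain s where s: "z = ereal s" "0 \<le> s" "s = ?S (Suc (N (\<rho> * s) \<omega>))"
        by (auto simp: workload_eq)
      have "\<not> Suc (N (\<rho> * s) \<omega>) \<le> n"
        using alive s(3) by (metis Suc_n_not_le_n atLeastAtMost_iff le_add1 plus_1_eq_Suc)
      then have "?S n \<le> s" using S_mono[of n "Suc (N (\<rho> * s) \<omega>)"] s(3) by simp
      then show "ereal (?S n) \<le> z" using s by simp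
    qed
    moreover have "n \<le> N (\<rho> * ?S n) \<omega>"
      using alive by (cases "n = 0") auto
    ultimately show "\<exists>t\<ge>0. ereal t \<le> hitting_time Bs N \<rho> \<omega> \<and> n \<le> N (\<rho> * t) \<omega>"
      using S_nonneg by blast
  qed
qed

context poisson_queue
begin

abbreviation path :: "'a \<Rightarrow> real \<Rightarrow> nat" where
  "path \<omega> \<equiv> right_eval (\<lambda>t\<in>{0..}. N t \<omega>)"

lemma N_mono: "\<omega> \<in> space M \<Longrightarrow> mono_on {0..} (\<lambda>t. N t \<omega>)"
  using poisson by (auto simp: poisson_process_def)

text \<open>
  On a null set service times may fail to be positive, and measurability has to hold there too. So the
  hitting time is described without positivity, as an infimum over its countably many possible values.
\<close>
lemma hitting_time_eq:
  assumes "\<omega> \<in> space M"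
  shows "hitting_time X N \<rho> \<omega> =
    (INF k. if 0 \<le> work (Suc k) \<omega> \<and> path \<omega> (\<rho> * work (Suc k) \<omega>) = k then ereal (work (Suc k) \<omega>) else \<infinity>)"
proof (rule antisym)
  have eq: "path \<omega> (\<rho> * t) = N (\<rho> * t) \<omega>" if "0 \<le> t" for t
    using right_eval_N[OF assms, of "\<rho> * t"] that rho_pos by simp
  show "hitting_time X N \<rho> \<omega> \<le>
    (INF k. if 0 \<le> work (Suc k) \<omega> \<and> path \<omega> (\<rho> * work (Suc k) \<omega>) = k then ereal (work (Suc k) \<omega>) else \<infinity>)"
  proof (rule INF_greatest)
    fix k
    show "hitting_time X N \<rho> \<omega> \<le> (if 0 \<le> work (Suc k) \<omega> \<and> path \<omega> (\<rho> * work (Suc k) \<omega>) = k then ereal (work (Suc k) \<omega>) else \<infinity>)"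
    proof (cases "0 \<le> work (Suc k) \<omega> \<and> path \<omega> (\<rho> * work (Suc k) \<omega>) = k")
      case True
      then have "workload X N \<rho> (work (Suc k) \<omega>) \<omega> = 0"
        using eq[of "work (Suc k) \<omega>"] by (simp add: workload_eq work_def del: sum.lessThan_Suc)
      then have "hitting_time X N \<rho> \<omega> \<le> ereal (work (Suc k) \<omega>)"
        unfolding hitting_time_def using True by (intro Inf_lower) auto
      then show ?thesis using True by simp
    qed auto
  qed
  show "(INF k. if 0 \<le> work (Suc k) \<omega> \<and> path \<omega> (\<rho> * work (Suc k) \<omega>) = k then ereal (work (Suc k) \<omega>) else \<infinity>)
      \<le> hitting_time X N \<rho> \<omega>"
    unfolding hitting_time_def
  proof (rule Inf_greatest)
    fix z assume "z \<in> ereal ` {t. 0 \<le> t \<and> workload X N \<rho> t \<omega> = 0}"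
    then obtain s where s: "z = ereal s" "0 \<le> s" "work (Suc (N (\<rho> * s) \<omega>)) \<omega> = s"
      by (auto simp: workload_eq work_def)
    then show "(INF k. if 0 \<le> work (Suc k) \<omega> \<and> path \<omega> (\<rho> * work (Suc k) \<omega>) = k then ereal (work (Suc k) \<omega>) else \<infinity>) \<le> z"
      using eq[OF s(2)] by (intro INF_lower2[of "N (\<rho> * s) \<omega>"]) auto
  qed
qed

lemma measurable_hitting_time [measurable]: "hitting_time X N \<rho> \<in> borel_measurable M"
proof -
  note [measurable] = measurable_right_eval[OF measurable_N_path]
  have "(\<lambda>\<omega>. INF k. if 0 \<le> work (Suc k) \<omega> \<and> path \<omega> (\<rho> * work (Suc k) \<omega>) = k then ereal (work (Suc k) \<omega>) else \<infinity>)
      \<in> borel_measurable M"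
    by measurable
  then show ?thesis
    by (subst measurable_cong[OF hitting_time_eq])
qed

text \<open>
  Since the counting path is monotone, the best time not exceeding the hitting time is the hitting time itself if
  it is finite, and a large integer otherwise.
\<close>
lemma measurable_largest_jump_gt [measurable]: "Measurable.pred M (\<lambda>\<omega>. ereal x < largest_jump X N \<rho> \<omega>)"
proof -
  note [measurable] = measurable_right_eval[OF measurable_N_path]
  have iff: "(\<exists>t\<ge>0. ereal t \<le> hitting_time X N \<rho> \<omega> \<and> n \<le> N (\<rho> * t) \<omega>) \<longleftrightarrow>
      (if hitting_time X N \<rho> \<omega> = \<infinity> then \<exists>k::nat. n \<le> path \<omega> (\<rho> * real k)
       else n \<le> path \<omega> (\<rho> * real_of_ereal (hitting_time X N \<rho> \<omega>)))" (is "?L \<longleftrightarrow> ?R")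
    if \<omega>: "\<omega> \<in> space M" for \<omega> n
  proof -
    have eq: "path \<omega> (\<rho> * t) = N (\<rho> * t) \<omega>" if "0 \<le> t" for t
      using right_eval_N[OF \<omega>, of "\<rho> * t"] that rho_pos by simp
    have mono: "0 \<le> s \<Longrightarrow> s \<le> t \<Longrightarrow> N (\<rho> * s) \<omega> \<le> N (\<rho> * t) \<omega>" for s t
      using N_mono[OF \<omega>] rho_pos by (auto simp: mono_on_def)
    have "0 \<le> hitting_time X N \<rho> \<omega>"
      unfolding hitting_time_def by (rule Inf_greatest) auto
    then consider "hitting_time X N \<rho> \<omega> = \<infinity>" | h where "0 \<le> h" "hitting_time X N \<rho> \<omega> = ereal h"
      by (cases "hitting_time X N \<rho> \<omega>") auto
    then show ?thesis
    proof cases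
      case 1
      have "?L \<longleftrightarrow> (\<exists>k::nat. n \<le> N (\<rho> * real k) \<omega>)"
      proof
        assume ?L
        then obtain t where t: "0 \<le> t" "n \<le> N (\<rho> * t) \<omega>" by blast
        obtain k :: nat where "t \<le> real k" using real_arch_simple by blast
        then show "\<exists>k::nat. n \<le> N (\<rho> * real k) \<omega>"
          using t mono[of t "real k"] order_trans by blast
      next
        assume "\<exists>k::nat. n \<le> N (\<rho> * real k) \<omega>"
        then obtain k :: nat where "n \<le> N (\<rho> * real k) \<omega>" by blast
        then show ?L using 1 by (intro exI[of _ "real k"]) simp
      qed
      with 1 show ?thesis by (simp add: eq)
    next
      case 2
      have "?L \<longleftrightarrow> n \<le> N (\<rho> * h) \<omega>"
      proof (intro iffI)
        assume ?L
        then obtain t where "0 \<le> t" "t \<le> h" "n \<le> N (\<rho> * t) \<omega>" using 2 by auto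
        then show "n \<le> N (\<rho> * h) \<omega>" using mono[of t h] by simp
      next
        assume "n \<le> N (\<rho> * h) \<omega>"
        then show ?L using 2 by (intro exI[of _ h]) simp
      qed
      with 2 show ?thesis by (simp add: eq)
    qed
  qed
  have "ereal x < largest_jump X N \<rho> \<omega> \<longleftrightarrow> (\<exists>n. x < X n \<omega> \<and>
      (if hitting_time X N \<rho> \<omega> = \<infinity> then \<exists>k::nat. n \<le> path \<omega> (\<rho> * real k)
       else n \<le> path \<omega> (\<rho> * real_of_ereal (hitting_time X N \<rho> \<omega>))))" if "\<omega> \<in> space M" for \<omega>
    unfolding largest_jump_def less_SUP_iff iff[OF that, symmetric] by auto
  moreover have "Measurable.pred M (\<lambda>\<omega>. \<exists>n. x < X n \<omega> \<and>
      (if hitting_time X N \<rho> \<omega> = \<infinity> then \<exists>k::nat. n \<le> path \<omega> (\<rho> * real k)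
       else n \<le> path \<omega> (\<rho> * real_of_ereal (hitting_time X N \<rho> \<omega>))))"
    by measurable
  ultimately show ?thesis by (simp cong: measurable_cong)
qed

lemma sum_arrivals:
  assumes \<omega>: "\<omega> \<in> space M" and pos: "\<And>i. 0 < X i \<omega>"
  shows "(\<Sum>i<m. arrivals i \<omega>) = N (\<rho> * work m \<omega>) \<omega>"
proof (induction m)
  case 0
  then show ?case using poisson \<omega> by (auto simp: poisson_process_def work_def)
next
  case (Suc m)
  have nonneg: "0 \<le> work k \<omega>" for k
    using pos unfolding work_def by (intro sum_nonneg) (auto intro: less_imp_le)
  have "work m \<omega> \<le> work (Suc m) \<omega>"
    using pos[of m] by (simp add: work_def)
  then have "N (\<rho> * work m \<omega>) \<omega> \<le> N (\<rho> * work (Suc m) \<omega>) \<omega>"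
    using N_mono[OF \<omega>] nonneg rho_pos by (auto simp: mono_on_def)
  moreover have "arrivals m \<omega> = N (\<rho> * work (Suc m) \<omega>) \<omega> - N (\<rho> * work m \<omega>) \<omega>"
    using nonneg rho_pos \<omega> by (simp add: arrivals_def right_eval_N)
  ultimately show ?case using Suc by simp
qed

lemma prob_largest_jump_gt:
  "\<P>(\<omega> in M. ereal x < largest_jump X N \<rho> \<omega>) = \<P>(\<omega> in M. \<exists>n. alive (\<lambda>i. arrivals i \<omega>) n \<and> x < X n \<omega>)"
proof (rule finite_measure_eq_AE)
  show "{\<omega> \<in> space M. \<exists>n. alive (\<lambda>i. arrivals i \<omega>) n \<and> x < X n \<omega>} \<in> events"
  proof -
    have [measurable]: "Measurable.pred M (\<lambda>\<omega>. alive (\<lambda>i. arrivals i \<omega>) n)" for n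
      by (rule measurable_alive) measurable
    show ?thesis by measurable
  qed
  show "AE \<omega> in M. \<omega> \<in> {\<omega> \<in> space M. ereal x < largest_jump X N \<rho> \<omega>} \<longleftrightarrow>
      \<omega> \<in> {\<omega> \<in> space M. \<exists>n. alive (\<lambda>i. arrivals i \<omega>) n \<and> x < X n \<omega>}"
    using AE_X_pos AE_space
  proof eventually_elim
    case (elim \<omega>)
    have "ereal x < largest_jump X N \<rho> \<omega> \<longleftrightarrow>
        (\<exists>n. (\<exists>t\<ge>0. ereal t \<le> hitting_time X N \<rho> \<omega> \<and> n \<le> N (\<rho> * t) \<omega>) \<and> x < X n \<omega>)"
      unfolding largest_jump_def less_SUP_iff by auto
    also have "\<dots> \<longleftrightarrow> (\<exists>n. alive (\<lambda>i. arrivals i \<omega>) n \<and> x < X n \<omega>)"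
      using elim by (subst index_before_hitting_iff)
        (auto simp: alive_def sum_arrivals N_mono rho_pos work_def)
    finally show ?case by simp
  qed
qed measurable

end

text \<open>
  By Markov's inequality restricted to the tail, \<open>y\<^sup>2 P(B > y)\<close> is at most \<open>E[B\<^sup>2; B > y]\<close>, which vanishes by dominated
  convergence.
\<close>
lemma (in prob_space) square_times_tail_tendsto_0:
  assumes [measurable]: "random_variable borel B" and sq: "integrable M (\<lambda>\<omega>. (B \<omega>)\<^sup>2)"
  shows "((\<lambda>y. y\<^sup>2 * \<P>(\<omega> in M. y < B \<omega>)) \<longlongrightarrow> 0) at_top"
proof (rule tendsto_sandwich[OF _ _ tendsto_const])
  have "((\<lambda>y. expectation (\<lambda>\<omega>. (B \<omega>)\<^sup>2 * of_bool (y < B \<omega>))) \<longlongrightarrow> expectation (\<lambda>\<omega>. 0)) at_top"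
  proof (rule integral_dominated_convergence_at_top[OF _ _ sq])
    show "AE \<omega> in M. ((\<lambda>y. (B \<omega>)\<^sup>2 * of_bool (y < B \<omega>)) \<longlongrightarrow> 0) at_top"
    proof (rule AE_I2)
      fix \<omega>
      have "eventually (\<lambda>y. 0 = (B \<omega>)\<^sup>2 * of_bool (y < B \<omega>)) at_top"
        using eventually_ge_at_top[of "B \<omega>"] by eventually_elim auto
      then show "((\<lambda>y. (B \<omega>)\<^sup>2 * of_bool (y < B \<omega>)) \<longlongrightarrow> 0) at_top"
        by (rule Lim_transform_eventually[OF tendsto_const])
    qed
  qed (auto intro!: always_eventually)
  then show "((\<lambda>y. expectation (\<lambda>\<omega>. (B \<omega>)\<^sup>2 * of_bool (y < B \<omega>))) \<longlongrightarrow> 0) at_top"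
    by simp
  show "\<forall>\<^sub>F y in at_top. y\<^sup>2 * \<P>(\<omega> in M. y < B \<omega>) \<le> expectation (\<lambda>\<omega>. (B \<omega>)\<^sup>2 * of_bool (y < B \<omega>))"
    using eventually_ge_at_top[of 0]
  proof eventually_elim
    case (elim y)
    have "y\<^sup>2 * \<P>(\<omega> in M. y < B \<omega>) = expectation (\<lambda>\<omega>. y\<^sup>2 * of_bool (y < B \<omega>))"
      by (simp add: expectation_of_bool)
    also have "\<dots> \<le> expectation (\<lambda>\<omega>. (B \<omega>)\<^sup>2 * of_bool (y < B \<omega>))"
    proof (rule integral_mono)
      show "integrable M (\<lambda>\<omega>. y\<^sup>2 * of_bool (y < B \<omega>))"
        by (rule integrable_const_bound[where B="y\<^sup>2"]) auto
      show "integrable M (\<lambda>\<omega>. (B \<omega>)\<^sup>2 * of_bool (y < B \<omega>))"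
        by (rule Bochner_Integration.integrable_bound[OF sq]) auto
      show "y\<^sup>2 * of_bool (y < B \<omega>) \<le> (B \<omega>)\<^sup>2 * of_bool (y < B \<omega>)" for \<omega>
        using elim by (auto intro!: power_mono)
    qed
    finally show ?case .
  qed
qed auto

text \<open>
  Division by zero gives \<open>0\<close>, so a ratio near \<open>1\<close> forces a nonzero denominator. This is what makes the tail of
  \<open>B\<close> positive everywhere and the relative error meaningful.
\<close>
lemma slowly_varying_eventually_nonzero:
  assumes "slowly_varying L"
  shows "eventually (\<lambda>x. L x \<noteq> 0) at_top"
proof -
  have "((\<lambda>x. L (1 * x) / L x) \<longlongrightarrow> 1) at_top"
    using assms unfolding slowly_varying_def by (metis zero_less_one)
  then have "eventually (\<lambda>x. L (1 * x) / L x > 0) at_top"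
    by (rule order_tendstoD) simp
  then show ?thesis by (rule eventually_mono) auto
qed

text \<open>
  The relative error at \<open>x\<close> is at most the square root of \<open>K * p x / (1 - \<rho>)\<^sup>2\<close>. As \<open>p\<close> is decreasing, the worst
  case in the supremum is its left end point \<open>xh \<rho>\<close>.
\<close>
lemma SUP_relative_error_tendsto_0:
  fixes P :: "real \<Rightarrow> real \<Rightarrow> real" and p xh :: "real \<Rightarrow> real"
  assumes pos: "\<And>x. 0 < p x" and anti: "antimono p"
    and upper: "\<And>\<rho> x. 0 < \<rho> \<Longrightarrow> \<rho> < 1 \<Longrightarrow> P \<rho> x \<le> p x / (1 - \<rho>)"
    and lower: "\<And>\<rho> x. 0 < \<rho> \<Longrightarrow> \<rho> < 1 \<Longrightarrow> p x / (1 - \<rho>) * (1 - sqrt (K * p x) / (1 - \<rho>)) \<le> P \<rho> x"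
    and K: "0 \<le> K"
    and lim: "((\<lambda>\<rho>. p (xh \<rho>) / (1 - \<rho>)\<^sup>2) \<longlongrightarrow> 0) (at_left 1)"
  shows "((\<lambda>\<rho>. SUP x \<in> {xh \<rho>..}. ereal \<bar>P \<rho> x / (1 / (1 - \<rho>) * p x) - 1\<bar>) \<longlongrightarrow> 0) (at_left 1)"
proof (rule tendsto_sandwich[OF _ _ tendsto_const])
  let ?u = "\<lambda>\<rho>. sqrt (K * (p (xh \<rho>) / (1 - \<rho>)\<^sup>2))"
  have "(?u \<longlongrightarrow> sqrt (K * 0)) (at_left 1)"
    by (intro tendsto_intros lim)
  then show "((\<lambda>\<rho>. ereal (?u \<rho>)) \<longlongrightarrow> 0) (at_left 1)"
    by (simp add: zero_ereal_def)
  have "eventually (\<lambda>\<rho>::real. 0 < \<rho> \<and> \<rho> < 1) (at_left 1)"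
    using eventually_at_left_real[of 0 "1::real"] by (auto elim: eventually_mono)
  then show "\<forall>\<^sub>F \<rho> in at_left 1. (SUP x \<in> {xh \<rho>..}. ereal \<bar>P \<rho> x / (1 / (1 - \<rho>) * p x) - 1\<bar>) \<le> ereal (?u \<rho>)"
  proof eventually_elim
    case (elim \<rho>)
    show ?case
    proof (rule SUP_least)
      fix x assume x: "x \<in> {xh \<rho>..}"
      define d where "d = p x / (1 - \<rho>)"
      have d: "0 < d" using pos[of x] elim by (simp add: d_def)
      have "P \<rho> x / d \<le> 1"
        using upper[of \<rho> x] elim d by (simp add: d_def[symmetric])
      moreover have "1 - sqrt (K * p x) / (1 - \<rho>) \<le> P \<rho> x / d"
        using lower[of \<rho> x] elim d by (simp add: d_def[symmetric] pos_le_divide_eq mult.commute)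
      moreover have "sqrt (K * p x) / (1 - \<rho>) \<le> ?u \<rho>"
      proof -
        have "sqrt (K * p x) \<le> sqrt (K * p (xh \<rho>))"
          using antimonoD[OF anti, of "xh \<rho>" x] x K by (intro real_sqrt_le_mono mult_left_mono) auto
        then have "sqrt (K * p x) / (1 - \<rho>) \<le> sqrt (K * p (xh \<rho>)) / (1 - \<rho>)"
          using elim by (intro divide_right_mono) auto
        also have "\<dots> = ?u \<rho>"
          using elim by (simp add: real_sqrt_divide real_sqrt_mult)
        finally show ?thesis .
      qed
      ultimately show "ereal \<bar>P \<rho> x / (1 / (1 - \<rho>) * p x) - 1\<bar> \<le> ereal (?u \<rho>)"
        by (simp add: d_def)
    qed
  qed
  show "\<forall>\<^sub>F \<rho> in at_left 1. 0 \<le> (SUP x \<in> {xh \<rho>..}. ereal \<bar>P \<rho> x / (1 / (1 - \<rho>) * p x) - 1\<bar>)"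
    by (intro always_eventually allI SUP_upper2[of "xh _"]) auto
qed

theorem theorem3p3:
  fixes M :: "'a measure"
    and B :: "'a \<Rightarrow> real"
    and Bs :: "nat \<Rightarrow> 'a \<Rightarrow> real"
    and N :: "real \<Rightarrow> 'a \<Rightarrow> nat"
    and L :: "real \<Rightarrow> real"
    and \<alpha> :: real
  assumes "prob_space M"
    and "B \<in> borel_measurable M"
    and "prob_space.indep_vars M (\<lambda>_. borel) Bs UNIV"
    and "\<And>i. distr M borel (Bs i) = distr M borel B"
    and "AE \<omega> in M. 0 \<le> B \<omega>"
    and "\<P>(\<omega> in M. B \<omega> \<le> 0) = 0"
    and "integrable M B"
    and "0 < (\<integral>\<omega>. B \<omega> \<partial>M)"
    and "integrable M (\<lambda>\<omega>. (B \<omega>)\<^sup>2)"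
    and "poisson_process M (1 / (\<integral>\<omega>. B \<omega> \<partial>M)) N"
    and "prob_space.indep_set M
           (sets (vimage_algebra (space M) (\<lambda>\<omega>. \<lambda>i\<in>UNIV. Bs i \<omega>) (PiM UNIV (\<lambda>_. borel))))
           (sets (vimage_algebra (space M) (\<lambda>\<omega>. \<lambda>t\<in>{0..}. N t \<omega>) (PiM {0..} (\<lambda>_. count_space UNIV))))"
    and "2 < \<alpha>" and "\<alpha> \<noteq> 3"
    and "slowly_varying L"
    and "\<And>x. 0 < x \<Longrightarrow> \<P>(\<omega> in M. x < B \<omega>) = L x * x powr (- \<alpha>)"
  shows "(\<forall>xh :: real \<Rightarrow> real.
            ((\<lambda>\<rho>. \<P>(\<omega> in M. xh \<rho> < B \<omega>) / (1 - \<rho>)\<^sup>2) \<longlongrightarrow> 0) (at_left 1) \<longrightarrow>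
            ((\<lambda>\<rho>. SUP x \<in> {xh \<rho>..}.
                 ereal \<bar>\<P>(\<omega> in M. ereal x < largest_jump Bs N \<rho> \<omega>) /
                        (1 / (1 - \<rho>) * \<P>(\<omega> in M. x < B \<omega>)) - 1\<bar>) \<longlongrightarrow> 0) (at_left 1)) \<and>
         (\<forall>xh :: real \<Rightarrow> real.
            (\<forall>\<rho>\<in>{0<..<1}. xh \<rho> \<ge> 1 / (1 - \<rho>)) \<longrightarrow>
            ((\<lambda>\<rho>. SUP x \<in> {xh \<rho>..}.
                 ereal \<bar>\<P>(\<omega> in M. ereal x < largest_jump Bs N \<rho> \<omega>) /
                        (1 / (1 - \<rho>) * \<P>(\<omega> in M. x < B \<omega>)) - 1\<bar>) \<longlongrightarrow> 0) (at_left 1))"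
proof -
  let ?EB = "\<integral>\<omega>. B \<omega> \<partial>M" and ?p = "\<lambda>x. \<P>(\<omega> in M. x < B \<omega>)"
  interpret prob_space M by fact
  have [measurable]: "B \<in> borel_measurable M" by fact
  have Bs [measurable]: "Bs i \<in> borel_measurable M" for i
    using assms(3) by (auto simp: indep_vars_def)
  have tail_transfer: "\<P>(\<omega> in M. Bs i \<omega> \<in> S) = \<P>(\<omega> in M. B \<omega> \<in> S)" if "S \<in> sets borel" for i S
  proof -
    have "measure (distr M borel (Bs i)) S = measure (distr M borel B) S"
      by (simp add: assms(4))
    then show ?thesis
      using that by (simp add: measure_distr vimage_def Int_def conj_commute)
  qed
  have expectation_transfer: "expectation (\<lambda>\<omega>. h (Bs i \<omega>)) = expectation (\<lambda>\<omega>. h (B \<omega>))"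
    and integrable_transfer: "integrable M (\<lambda>\<omega>. h (Bs i \<omega>)) \<longleftrightarrow> integrable M (\<lambda>\<omega>. h (B \<omega>))"
    if "h \<in> borel_measurable borel" for i and h :: "real \<Rightarrow> real"
    using that integral_distr[of "Bs i" M borel h] integral_distr[of B M borel h]
      integrable_distr_eq[of "Bs i" M borel h] integrable_distr_eq[of B M borel h]
    by (auto simp: assms(4))
  define v where "v = 1 + (1 / ?EB)\<^sup>2 * expectation (\<lambda>\<omega>. (B \<omega>)\<^sup>2)"
  have bounds: "\<P>(\<omega> in M. ereal x < largest_jump Bs N \<rho> \<omega>) \<le> ?p x / (1 - \<rho>)"
      "?p x / (1 - \<rho>) * (1 - sqrt ((v + 1) * ?p x) / (1 - \<rho>)) \<le> \<P>(\<omega> in M. ereal x < largest_jump Bs N \<rho> \<omega>)"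
    if \<rho>: "0 < \<rho>" "\<rho> < 1" for \<rho> x
  proof -
    interpret Q: poisson_queue M Bs N "1 / ?EB" \<rho>
    proof
      show "AE \<omega> in M. 0 < Bs i \<omega>" for i
      proof -
        have "\<P>(\<omega> in M. Bs i \<omega> \<le> 0) = 0"
          using tail_transfer[of "{..0}" i] assms(6) by simp
        then have "AE \<omega> in M. \<not> Bs i \<omega> \<le> 0"
          by (subst (asm) prob_eq_0) auto
        then show ?thesis by (simp add: not_le)
      qed
    qed (use assms \<rho> in auto)
    interpret I: iid_queue M Q.arrivals Bs \<rho> v
      unfolding v_def
    proof (rule Q.iid_queue_arrivals)
      show "integrable M (\<lambda>\<omega>. (Bs i \<omega>)\<^sup>2)" for i
        using integrable_transfer[of "\<lambda>x. x\<^sup>2" i] assms(9) by simp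
      show "1 / ?EB * expectation (Bs i) = 1" for i
        using expectation_transfer[of "\<lambda>x. x" i] assms(8) by simp
      show "expectation (\<lambda>\<omega>. (Bs i \<omega>)\<^sup>2) = expectation (\<lambda>\<omega>. (B \<omega>)\<^sup>2)" for i
        using expectation_transfer[of "\<lambda>x. x\<^sup>2" i] by simp
    qed fact
    have p: "\<P>(\<omega> in M. x < Bs n \<omega>) = ?p x" for n
      using tail_transfer[of "{x<..}" n] by simp
    show "\<P>(\<omega> in M. ereal x < largest_jump Bs N \<rho> \<omega>) \<le> ?p x / (1 - \<rho>)"
      unfolding Q.prob_largest_jump_gt by (rule I.exceedance_le[OF p])
    show "?p x / (1 - \<rho>) * (1 - sqrt ((v + 1) * ?p x) / (1 - \<rho>)) \<le> \<P>(\<omega> in M. ereal x < largest_jump Bs N \<rho> \<omega>)"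
      unfolding Q.prob_largest_jump_gt by (rule I.exceedance_ge[OF p])
  qed
  have anti: "antimono ?p"
    by (intro antimonoI finite_measure_mono) auto
  have pos: "0 < ?p x" for x
  proof -
    have "eventually (\<lambda>y. L y \<noteq> 0 \<and> y > max x 0) at_top"
      using slowly_varying_eventually_nonzero[OF assms(14)] eventually_gt_at_top
      by (rule eventually_conj)
    then obtain y where y: "L y \<noteq> 0" "y > max x 0"
      using eventually_happens'[OF trivial_limit_at_top_linorder] by blast
    then have "?p y \<noteq> 0" using assms(15)[of y] by simp
    moreover have "?p y \<le> ?p x" using antimonoD[OF anti, of x y] y by simp
    ultimately show ?thesis by (smt (verit) measure_nonneg)
  qed
  have "0 \<le> v + 1"
    unfolding v_def by simp
  then have main: "((\<lambda>\<rho>. SUP x \<in> {xh \<rho>..}. ereal \<bar>\<P>(\<omega> in M. ereal x < largest_jump Bs N \<rho> \<omega>) /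
        (1 / (1 - \<rho>) * ?p x) - 1\<bar>) \<longlongrightarrow> 0) (at_left 1)"
    if "((\<lambda>\<rho>. ?p (xh \<rho>) / (1 - \<rho>)\<^sup>2) \<longlongrightarrow> 0) (at_left 1)" for xh :: "real \<Rightarrow> real"
    using SUP_relative_error_tendsto_0[of ?p "\<lambda>\<rho> x. \<P>(\<omega> in M. ereal x < largest_jump Bs N \<rho> \<omega>)" "v + 1" xh,
        OF pos anti bounds _ that] by blast
  show ?thesis
  proof (intro conjI allI impI)
    fix xh :: "real \<Rightarrow> real"
    assume "((\<lambda>\<rho>. ?p (xh \<rho>) / (1 - \<rho>)\<^sup>2) \<longlongrightarrow> 0) (at_left 1)"
    then show "((\<lambda>\<rho>. SUP x \<in> {xh \<rho>..}. ereal \<bar>\<P>(\<omega> in M. ereal x < largest_jump Bs N \<rho> \<omega>) /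
        (1 / (1 - \<rho>) * ?p x) - 1\<bar>) \<longlongrightarrow> 0) (at_left 1)"
      by (rule main)
  next
    fix xh :: "real \<Rightarrow> real"
    assume xh: "\<forall>\<rho>\<in>{0<..<1}. xh \<rho> \<ge> 1 / (1 - \<rho>)"
    have "filterlim (\<lambda>\<rho>::real. 1 / (1 - \<rho>)) at_top (at_left 1)"
      by real_asymp
    from filterlim_compose[OF square_times_tail_tendsto_0[OF assms(2) assms(9)] this]
    have "((\<lambda>\<rho>. (1 / (1 - \<rho>))\<^sup>2 * ?p (1 / (1 - \<rho>))) \<longlongrightarrow> 0) (at_left 1)" .
    then have "((\<lambda>\<rho>. ?p (xh \<rho>) / (1 - \<rho>)\<^sup>2) \<longlongrightarrow> 0) (at_left 1)"
    proof (rule tendsto_sandwich[rotated 3])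
      show "\<forall>\<^sub>F \<rho> in at_left 1. ?p (xh \<rho>) / (1 - \<rho>)\<^sup>2 \<le> (1 / (1 - \<rho>))\<^sup>2 * ?p (1 / (1 - \<rho>))"
        using eventually_at_left_real[of 0 "1::real"]
      proof (rule eventually_mono)
        fix \<rho> :: real assume "\<rho> \<in> {0<..<1}"
        then have "?p (xh \<rho>) \<le> ?p (1 / (1 - \<rho>))"
          using xh antimonoD[OF anti] by blast
        then show "?p (xh \<rho>) / (1 - \<rho>)\<^sup>2 \<le> (1 / (1 - \<rho>))\<^sup>2 * ?p (1 / (1 - \<rho>))"
          by (simp add: power_divide divide_right_mono)
      qed simp
    qed auto
    then show "((\<lambda>\<rho>. SUP x \<in> {xh \<rho>..}. ereal \<bar>\<P>(\<omega> in M. ereal x < largest_jump Bs N \<rho> \<omega>) /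
        (1 / (1 - \<rho>) * ?p x) - 1\<bar>) \<longlongrightarrow> 0) (at_left 1)"
      by (rule main)
  qed
qed

end
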